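(* Let $s$ be a Sturmian word, let $\alpha$ be its slope, and let \[\alpha=m_0+\cfrac{1}{m_1+\cfrac{1}{m_2+\cfrac{1}{m_3+\cdots}}}\] be the continued fraction expansion of $\alpha$. Then $s$ is infinite closed-rich if and only if the sequence $(m_i)_{i\ge 1}$ is bounded.
   Context: Infinite words are one-sided sequences over a finite alphabet. A Sturmian word is an infinite word over $\{0,1\}$ having exactly $n+1$ distinct factors of each length $n\ge 1$; equivalently, an aperiodic binary word that is balanced (for any two factors $u,v$ of equal length and each letter $a$, the numbers of occurrences of $a$ in $u$ and in $v$ differ by at most $1$). The slope of a Sturmian word is the frequency of the letter $1$ in it (which exists and is irrational). A factor of a word is a contiguous finite subword. A border of a finite word $v$ is a proper prefix of $v$ which is also a suffix of $v$. A finite word $v$ is closed if $|v|\le 1$, or if $|v|\ge 2$ and the longest border of $v$ is non-empty and occurs in $v$ exactly twice (as a prefix and as a suffix). An infinite word $w$ is (infinite) closed-rich if there exists a constant $C>0$ such that for each $n\in\mathbb{N}$ each factor of $w$ of length $n$ contains at least $Cn^2$ distinct closed factors. *)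

theory Defs
  imports "HOL-Analysis.Analysis" "HOL-Library.Sublist"
begin

(* An infinite word is a function of type nat => 'a, a finite word is a list. *)

definition factors_of_length :: "(nat \<Rightarrow> 'a) \<Rightarrow> nat \<Rightarrow> 'a list set" where
  "factors_of_length w n = {map w [i..<i + n] | i. True}"

definition sturmian :: "(nat \<Rightarrow> nat) \<Rightarrow> bool" where
  "sturmian s \<longleftrightarrow> range s \<subseteq> {0, 1} \<and> (\<forall>n\<ge>1. card (factors_of_length s n) = n + 1)"

definition letter_frequency :: "(nat \<Rightarrow> 'a) \<Rightarrow> 'a \<Rightarrow> real" where
  "letter_frequency w a = lim (\<lambda>n. real (card {i. i < n \<and> w i = a}) / real n)"

definition slope :: "(nat \<Rightarrow> nat) \<Rightarrow> real" where
  "slope s = letter_frequency s 1"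

definition border :: "'a list \<Rightarrow> 'a list \<Rightarrow> bool" where
  "border u v \<longleftrightarrow> strict_prefix u v \<and> suffix u v"

definition longest_border :: "'a list \<Rightarrow> 'a list \<Rightarrow> bool" where
  "longest_border u v \<longleftrightarrow> border u v \<and> (\<forall>u'. border u' v \<longrightarrow> length u' \<le> length u)"

definition occurrences :: "'a list \<Rightarrow> 'a list \<Rightarrow> nat set" where
  "occurrences u v = {i. i + length u \<le> length v \<and> take (length u) (drop i v) = u}"

(* A border is a proper prefix, so its occurrences as a prefix and as a suffix start at different
   positions; card = 2 therefore says that there are no others. *)
definition closed_word :: "'a list \<Rightarrow> bool" where
  "closed_word v \<longleftrightarrow> length v \<le> 1 \<or>
     (\<exists>u. longest_border u v \<and> u \<noteq> [] \<and> card (occurrences u v) = 2)"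

definition closed_rich :: "(nat \<Rightarrow> 'a) \<Rightarrow> bool" where
  "closed_rich w \<longleftrightarrow>
     (\<exists>C::real. C > 0 \<and> (\<forall>n. \<forall>v\<in>factors_of_length w n.
        real (card {u. sublist u v \<and> closed_word u}) \<ge> C * (real n)\<^sup>2))"

(* m 0 + 1 / (m 1 + 1 / (... + 1 / m n)) *)
fun finite_cfrac :: "(nat \<Rightarrow> int) \<Rightarrow> nat \<Rightarrow> real" where
  "finite_cfrac m 0 = of_int (m 0)"
| "finite_cfrac m (Suc n) = of_int (m 0) + 1 / finite_cfrac (\<lambda>i. m (Suc i)) n"

definition cfrac_expansion :: "real \<Rightarrow> (nat \<Rightarrow> int) \<Rightarrow> bool" where
  "cfrac_expansion \<alpha> m \<longleftrightarrow> (\<forall>i\<ge>1. m i \<ge> 1) \<and> finite_cfrac m \<longlonglongrightarrow> \<alpha>"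

end

theory Submission
  imports Defs
begin

text \<open>
  Call a run of period \<open>q\<close> a stretch on which \<open>s (x + q) = s x\<close>. Both sides of the equivalence say
  that every run has length at most \<open>K * q\<close> for a fixed \<open>K\<close>. A factor of length \<open>n = K * q\<close> inside a longer
  run has at most \<open>(n + 1) * q\<close> factors altogether, too few when \<open>K\<close> is large. Conversely, by a
  local version of the Morse-Hedlund argument a long window avoiding some factor of length \<open>k\<close>
  contains a long run of period at most \<open>k\<close>; so if runs are bounded, all \<open>k + 1\<close> factors of length
  \<open>k\<close> occur twice in every window of length linear in \<open>k\<close>, and their complete returns are distinct
  closed factors.

  For the link with the continued fraction, \<open>s\<close> is balanced, so \<open>disc s n\<close>, the number of ones among
  the first \<open>n\<close> letters minus \<open>n * slope s\<close>, oscillates by at most 1 and moves like a rotation modulo 1.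
  Along a run of period \<open>q\<close> the shift by \<open>q\<close> changes \<open>disc s\<close> by the constant \<open>p - q * slope s\<close>, where
  \<open>p\<close> is the number of ones in a period, so long runs correspond to very good rational approximations
  \<open>p / q\<close> of the slope.
\<close>

subsection \<open>Windows, right special factors and balance\<close>

definition window :: "(nat \<Rightarrow> 'a) \<Rightarrow> nat \<Rightarrow> nat \<Rightarrow> 'a list" where
  "window s t n = map s [t..<t + n]"

lemma length_window [simp]: "length (window s t n) = n"
  by (simp add: window_def)

lemma window_0 [simp]: "window s t 0 = []"
  by (simp add: window_def)

lemma nth_window: "i < n \<Longrightarrow> window s t n ! i = s (t + i)"
  by (simp add: window_def)

lemma window_eq_iff: "window s t n = window s t' n \<longleftrightarrow> (\<forall>i<n. s (t + i) = s (t' + i))"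
  by (auto simp: list_eq_iff_nth_eq nth_window)

lemma window_Suc: "window s t (Suc n) = window s t n @ [s (t + n)]"
  by (simp add: window_def)

lemma window_Suc_Cons: "window s t (Suc n) = s t # window s (Suc t) n"
  by (auto simp: list_eq_iff_nth_eq nth_window nth_Cons split: nat.split)

lemma take_drop_window: "i + l \<le> n \<Longrightarrow> take l (drop i (window s t n)) = window s (t + i) l"
  by (auto simp: list_eq_iff_nth_eq nth_window add.assoc)

lemma factors_of_length_eq: "factors_of_length s n = range (\<lambda>t. window s t n)"
  by (auto simp: factors_of_length_def window_def)

lemma sublist_window_iff:
  "sublist u (window s a n) \<longleftrightarrow> (\<exists>i l. i + l \<le> n \<and> u = window s (a + i) l)"
proof
  assume "sublist u (window s a n)"
  then obtain ps ss where eq: "window s a n = ps @ u @ ss"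
    by (auto simp: sublist_def)
  have len: "length ps + length u \<le> n"
    using arg_cong[OF eq, of length] by simp
  have "u = take (length u) (drop (length ps) (window s a n))"
    by (simp add: eq)
  then have "u = window s (a + length ps) (length u)"
    by (metis len take_drop_window)
  then show "\<exists>i l. i + l \<le> n \<and> u = window s (a + i) l"
    using len by blast
next
  assume "\<exists>i l. i + l \<le> n \<and> u = window s (a + i) l"
  then obtain i l where "i + l \<le> n" "u = window s (a + i) l"
    by blast
  then have "u = take l (drop i (window s a n))"
    by (simp add: take_drop_window)
  then show "sublist u (window s a n)"
    by (metis sublist_drop sublist_order.order.trans sublist_take)
qed

lemma binary:
  assumes "sturmian s"
  shows "s t = 0 \<or> s t = 1"
  using assms by (auto simp: sturmian_def)

lemma card_factors:
  assumes "sturmian s"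
  shows "card (factors_of_length s n) = n + 1"
proof (cases n)
  case 0
  then show ?thesis
    by (simp add: factors_of_length_eq image_def)
next
  case (Suc k)
  then show ?thesis
    using assms by (auto simp: sturmian_def)
qed

lemma finite_factors:
  assumes "sturmian s"
  shows "finite (factors_of_length s n)"
  using card_factors[OF assms, of n] by (intro card_ge_0_finite) simp

section \<open>Right special factors: one for each length\<close>

definition right_special :: "(nat \<Rightarrow> nat) \<Rightarrow> nat \<Rightarrow> nat list set" where
  "right_special s n =
    {u. u @ [0] \<in> factors_of_length s (Suc n) \<and> u @ [1] \<in> factors_of_length s (Suc n)}"

text \<open>Sort the \<open>n + 2\<close> factors of length \<open>n + 1\<close> by their last
  letter and delete it. The two resulting sets cover the \<open>n + 1\<close> factors of length
  \<open>n\<close>, so their intersection, the right special factors, has one element.\<close>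

lemma card_right_special:
  assumes "sturmian s"
  shows "card (right_special s n) = 1"
proof -
  let ?F = "factors_of_length s"
  define B where "B a = {u. u @ [a] \<in> ?F (Suc n)}" for a
  have fin: "finite (B a)" for a
  proof -
    have "(\<lambda>u. u @ [a]) ` B a \<subseteq> ?F (Suc n)"
      by (auto simp: B_def)
    then show ?thesis
      by (rule finite_imageD[OF finite_subset[OF _ finite_factors[OF assms]]]) (simp add: inj_on_def)
  qed
  have F: "?F (Suc n) = (\<lambda>u. u @ [0]) ` B 0 \<union> (\<lambda>u. u @ [1]) ` B 1"
  proof -
    have "window s t (Suc n) \<in> (\<lambda>u. u @ [0]) ` B 0 \<union> (\<lambda>u. u @ [1]) ` B 1" for t
    proof -
      have "window s t n \<in> B (s (t + n))"
        using rangeI[of "\<lambda>t. window s t (Suc n)" t]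
        by (simp add: B_def factors_of_length_eq window_Suc)
      then show ?thesis
        using binary[OF assms, of "t + n"] by (auto simp: window_Suc)
    qed
    then have "?F (Suc n) \<subseteq> (\<lambda>u. u @ [0]) ` B 0 \<union> (\<lambda>u. u @ [1]) ` B 1"
      unfolding factors_of_length_eq by blast
    then show ?thesis
      by (auto simp: B_def)
  qed
  have "card (?F (Suc n)) = card ((\<lambda>u. u @ [0]) ` B 0) + card ((\<lambda>u. u @ [1::nat]) ` B 1)"
    unfolding F by (rule card_Un_disjoint) (auto simp: fin)
  also have "\<dots> = card (B 0) + card (B 1)"
    by (simp add: card_image inj_on_def)
  also have "\<dots> = card (B 0 \<union> B 1) + card (B 0 \<inter> B 1)"
    by (rule card_Un_Int) (auto simp: fin)
  also have "B 0 \<union> B 1 = ?F n"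
  proof -
    have "window s t n \<in> B 0 \<union> B 1" for t
      using binary[OF assms, of "t + n"] rangeI[of "\<lambda>t. window s t (Suc n)" t]
      by (auto simp: B_def factors_of_length_eq window_Suc)
    then show ?thesis
      by (auto simp: factors_of_length_eq B_def window_Suc)
  qed
  also have "B 0 \<inter> B 1 = right_special s n"
    by (auto simp: B_def right_special_def)
  finally show ?thesis
    by (simp add: card_factors[OF assms])
qed

lemma right_special_unique:
  assumes "sturmian s" "u \<in> right_special s n" "v \<in> right_special s n"
  shows "u = v"
  using card_right_special[OF assms(1), of n] assms(2,3) by (metis card_1_singletonE singletonD)

lemma right_specialI:
  assumes "sturmian s" "window s t n = window s t' n" "s (t + n) \<noteq> s (t' + n)"
  shows "window s t n \<in> right_special s n"
  using assms(2,3) binary[OF assms(1), of "t + n"] binary[OF assms(1), of "t' + n"]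
    rangeI[of "\<lambda>t. window s t (Suc n)" t] rangeI[of "\<lambda>t. window s t (Suc n)" t']
  by (auto simp: right_special_def factors_of_length_eq window_Suc)

text \<open>An eventual period would let every window of length \<open>j\<close> be moved back to a
  start below \<open>j\<close>, leaving at most \<open>j\<close> factors of that length.\<close>

lemma not_eventually_periodic:
  assumes "sturmian s" "i < j"
  shows "\<exists>k. s (i + k) \<noteq> s (j + k)"
proof (rule ccontr)
  assume "\<not> ?thesis"
  then have per: "s (i + k) = s (j + k)" for k
    by simp
  have "\<exists>t'<j. window s t j = window s t' j" for t
  proof (induction t rule: less_induct)
    case (less t)
    show ?case
    proof (cases "t < j")
      case False
      define t' where "t' = t - (j - i)"
      have "s (t + x) = s (t' + x)" for x
      proof -
        have "j + (t - j + x) = t + x" "i + (t - j + x) = t' + x"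
          using False assms(2) by (auto simp: t'_def)
        then show ?thesis
          using per[of "t - j + x"] by simp
      qed
      then have "window s t j = window s t' j"
        by (simp add: window_eq_iff)
      moreover have "t' < t"
        using False assms(2) by (simp add: t'_def)
      ultimately show ?thesis
        using less by auto
    qed blast
  qed
  then have "factors_of_length s j \<subseteq> (\<lambda>t. window s t j) ` {..<j}"
    by (auto simp: factors_of_length_eq)
  then have "card (factors_of_length s j) \<le> j"
    by (metis card_image_le card_lessThan card_mono finite_imageI finite_lessThan le_trans)
  then show False
    by (simp add: card_factors[OF assms(1)])
qed

section \<open>Counting ones; balance\<close>

definition ones :: "(nat \<Rightarrow> nat) \<Rightarrow> nat \<Rightarrow> nat \<Rightarrow> nat" where
  "ones s t n = (\<Sum>x<n. s (t + x))"

lemma ones_add: "ones s t (m + n) = ones s t m + ones s (t + m) n"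
proof (induction n)
  case (Suc n)
  then show ?case
    by (simp add: ones_def add.assoc)
qed (simp add: ones_def)

lemma ones_Suc: "ones s t (Suc n) = ones s t n + s (t + n)"
  by (simp add: ones_def)

text \<open>Minimality makes the counts on proper nonempty prefixes differ by exactly 1. Hence the
  two windows read 1w1 and 0w0 with a common word w of length \<open>L\<close>, and w is a
  palindrome because its first asymmetry would produce a shorter unbalanced pair.\<close>

lemma minimal_unbalanced:
  assumes st: "sturmian s"
    and unb: "ones s a n \<ge> ones s b n + 2"
    and min: "\<And>k t t'. k < n \<Longrightarrow> ones s t k \<le> ones s t' k + 1"
  obtains L where "n = L + 2" "s a = 1" "s b = 0" "s (a + L + 1) = 1" "s (b + L + 1) = 0"
    "\<And>k. k < L \<Longrightarrow> s (a + 1 + k) = s (b + 1 + k)"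
    "\<And>k. k < L \<Longrightarrow> s (a + 1 + k) = s (a + 1 + (L - 1 - k))"
proof -
  have diff: "ones s a k = ones s b k + 1" if "0 < k" "k < n" for k
  proof -
    have "ones s a n = ones s a k + ones s (a + k) (n - k)"
      "ones s b n = ones s b k + ones s (b + k) (n - k)"
      using ones_add[of s _ k "n - k"] that by simp_all
    moreover have "ones s (a + k) (n - k) \<le> ones s (b + k) (n - k) + 1"
      by (rule min) (use that in auto)
    moreover have "ones s a k \<le> ones s b k + 1"
      by (rule min) fact
    ultimately show ?thesis
      using unb by linarith
  qed
  have le1: "s t \<le> 1" for t
    using binary[OF st, of t] by auto
  have "n \<noteq> 0"
    using unb by (cases n) (simp_all add: ones_def)
  moreover have "n \<noteq> 1"
    using unb le1[of a] by (auto simp: ones_def)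
  ultimately obtain L where n: "n = L + 2"
    by (metis One_nat_def Suc_1 add.commute add_2_eq_Suc' not0_implies_Suc)
  have first: "s a = 1" "s b = 0"
    using diff[of 1] n le1[of a] by (auto simp: ones_def)
  have mid: "s (a + 1 + k) = s (b + 1 + k)" if "k < L" for k
    using diff[of "k + 1"] diff[of "k + 2"] that n by (simp add: ones_Suc)
  have last: "s (a + L + 1) = 1" "s (b + L + 1) = 0"
    using diff[of "L + 1"] n unb le1[of "a + L + 1"] by (simp_all add: ones_Suc)
  have pal: "s (a + 1 + k) = s (a + 1 + (L - 1 - k))" if "k < L" for k
    using that
  proof (induction k rule: less_induct)
    case (less k)
    let ?w = "\<lambda>k. s (a + 1 + k)"
    show ?case
    proof (rule ccontr)
      assume neq: "?w k \<noteq> ?w (L - 1 - k)"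
      \<comment> \<open>By the induction hypothesis \<open>k\<close> is the first asymmetry, so the
        first and the last \<open>k\<close> letters of the middle word are mirror images with equal
        sums.\<close>
      have "(\<Sum>x<k. ?w x) = (\<Sum>x<k. ?w (L - 1 - x))"
        using less by (intro sum.cong) auto
      also have "\<dots> = (\<Sum>x<k. ?w (L - k + x))"
        by (rule sum.reindex_bij_witness[of _ "\<lambda>x. k - 1 - x" "\<lambda>x. k - 1 - x"])
          (use less in \<open>auto intro!: arg_cong[of _ _ s]\<close>)
      finally have mid_eq: "(\<Sum>x<k. ?w x) = (\<Sum>x<k. ?w (L - k + x))" .
      have pre: "ones s t (k + 2) = s t + (\<Sum>x<k. s (t + 1 + x)) + s (t + 1 + k)" for t
        using ones_add[of s t 1 k] ones_Suc[of s t "k + 1"] by (simp add: ones_def)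
      have "k < L - 1 - k"
      proof (rule ccontr)
        assume "\<not> k < L - 1 - k"
        then have "L - 1 - k < k \<or> L - 1 - k = k"
          using less.prems by linarith
        then show False
        proof
          assume "L - 1 - k < k"
          then show False
            using less.IH[of "L - 1 - k"] less.prems neq by auto
        next
          assume "L - 1 - k = k"
          then show False
            using neq by metis
        qed
      qed
      then have k: "k + 2 < n" "k < L"
        using n by simp_all
      have sums: "(\<Sum>x<k. s (b + 1 + x)) = (\<Sum>x<k. ?w x)"
        "(\<Sum>x<k. s (a + (L - k) + 1 + x)) = (\<Sum>x<k. ?w x)"
        "(\<Sum>x<k. s (b + (L - k) + 1 + x)) = (\<Sum>x<k. ?w x)"
      proof -
        show "(\<Sum>x<k. s (b + 1 + x)) = (\<Sum>x<k. ?w x)"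
          using k mid by (intro sum.cong) auto
        show "(\<Sum>x<k. s (a + (L - k) + 1 + x)) = (\<Sum>x<k. ?w x)"
          unfolding mid_eq by (intro sum.cong) (auto simp: add_ac)
        show "(\<Sum>x<k. s (b + (L - k) + 1 + x)) = (\<Sum>x<k. ?w x)"
          unfolding mid_eq
        proof (intro sum.cong refl)
          fix x assume "x \<in> {..<k}"
          then show "s (b + (L - k) + 1 + x) = ?w (L - k + x)"
            using mid[of "L - k + x"] k by (simp add: add_ac)
        qed
      qed
      have ends: "s (a + (L - k)) = ?w (L - 1 - k)" "s (b + (L - k)) = ?w (L - 1 - k)"
        "s (b + 1 + k) = ?w k"
        using mid[of "L - 1 - k"] mid[of k] k by (simp_all add: Suc_diff_Suc)
      have lasts: "s (a + (L - k) + 1 + k) = 1" "s (b + (L - k) + 1 + k) = 0"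
        using last k by simp_all
      \<comment> \<open>Compare the prefix of length \<open>k + 2\<close> of one window with the
        suffix of that length of the other. Their middles have equal sums, and in each case the end
        letters are both 1 in one word and both 0 in the other.\<close>
      consider "?w k = 0" "?w (L - 1 - k) = 1" | "?w k = 1" "?w (L - 1 - k) = 0"
        using neq binary[OF st, of "a + 1 + k"] binary[OF st, of "a + 1 + (L - 1 - k)"] by metis
      then show False
      proof cases
        case 1
        have "ones s (a + (L - k)) (k + 2) = ones s b (k + 2) + 2"
          unfolding pre sums ends lasts first 1 by simp
        then show False
          using min[OF k(1), of "a + (L - k)" b] by linarith
      next
        case 2
        have "ones s a (k + 2) = ones s (b + (L - k)) (k + 2) + 2"
          unfolding pre sums ends lasts first 2 by simp
        then show False
          using min[OF k(1), of a "b + (L - k)"] by linarith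
      qed
    qed
  qed
  show ?thesis
    using that[OF n first last mid pal] .
qed


lemma right_special_step:
  assumes "sturmian s" "window s x n = window s y n" "window s x n \<notin> right_special s n"
  shows "s (x + n) = s (y + n)" "window s (Suc x) n = window s (Suc y) n"
proof -
  show "s (x + n) = s (y + n)"
    using right_specialI[OF assms(1,2)] assms(3) by blast
  then have "window s x (Suc n) = window s y (Suc n)"
    using assms(2) by (simp add: window_Suc)
  then show "window s (Suc x) n = window s (Suc y) n"
    by (simp add: window_Suc_Cons)
qed

lemma right_special_tl:
  assumes st: "sturmian s" and r: "r \<in> right_special s (Suc n)"
  obtains z where "r = z # tl r" "tl r \<in> right_special s n"
proof -
  from r obtain x y where xy: "window s x (Suc (Suc n)) = r @ [0]" "window s y (Suc (Suc n)) = r @ [1]"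
    by (auto simp: right_special_def factors_of_length_eq eq_commute[of "r @ _"])
  then have "r = window s x (Suc n)" "r = window s y (Suc n)" "s (x + Suc n) = 0" "s (y + Suc n) = 1"
    by (simp_all add: window_Suc[of _ _ "Suc n"])
  then show thesis
    using that[of "s x"] right_specialI[OF st, of "Suc x" n "Suc y"] by (simp add: window_Suc_Cons)
qed

lemma not_inj_on_less:
  fixes A :: "'a :: linorder set"
  assumes "\<not> inj_on f A"
  shows "\<exists>i\<in>A. \<exists>j\<in>A. i < j \<and> f i = f j"
proof -
  obtain i j where "i \<in> A" "j \<in> A" "i \<noteq> j" "f i = f j"
    using assms by (auto simp: inj_on_def)
  then show ?thesis
    by (metis linorder_neq_iff)
qed

text \<open>If \<open>r\<close> were missing, \<open>n + 1\<close> consecutive windows would take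
  only \<open>n\<close> values, so one repeats. No window in between is right special, so each
  determines its successor and the word cycles forever, against aperiodicity.\<close>

lemma right_special_recurrent:
  assumes st: "sturmian s" and "n > 0" and r: "r \<in> right_special s n"
  shows "\<exists>t\<le>n. window s (c + t) n = r"
proof (rule ccontr)
  assume "\<not> ?thesis"
  then have avoid: "window s (c + t) n \<noteq> r" if "t \<le> n" for t
    using that by blast
  let ?f = "\<lambda>t. window s t n"
  have "?f t \<in> factors_of_length s n" for t
    by (simp add: factors_of_length_eq)
  then have sub: "?f ` {c..c + n} \<subseteq> factors_of_length s n - {r}"
  proof clarify
    fix t assume "t \<in> {c..c + n}"
    then have "t - c \<le> n" "c + (t - c) = t"
      by auto
    then show "?f t \<in> factors_of_length s n - {r}"
      using avoid[of "t - c"] by (simp add: factors_of_length_eq)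
  qed
  have "r \<in> factors_of_length s n"
    using r by (auto simp: right_special_def factors_of_length_eq window_Suc)
  then have "card (factors_of_length s n - {r}) = n"
    by (simp add: card_factors[OF st])
  then have "card (?f ` {c..c + n}) \<le> n"
    using card_mono[OF _ sub] finite_factors[OF st, of n] by simp
  then have "\<not> inj_on ?f {c..c + n}"
    by (intro pigeonhole) simp
  then obtain i j where ij: "i < j" "c \<le> i" "j \<le> c + n" "?f i = ?f j"
    using not_inj_on_less[of ?f "{c..c + n}"] by auto
  have nonspecial: "?f t \<notin> right_special s n" if "c \<le> t" "t \<le> c + n" for t
  proof
    assume "?f t \<in> right_special s n"
    then have "window s (c + (t - c)) n = r"
      using right_special_unique[OF st r] that by simp
    moreover have "t - c \<le> n"
      using that by auto
    ultimately show False
      using avoid by blast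
  qed
  \<comment> \<open>From \<open>i\<close> on, the windows only run through those starting in the
    interval from \<open>i\<close> to \<open>j - 1\<close>, all of which lie in the range where
    \<open>r\<close> is absent.\<close>
  have orbit: "\<exists>t. i \<le> t \<and> t < j \<and> ?f (i + k) = ?f t" for k
  proof (induction k)
    case 0
    then show ?case
      using ij by auto
  next
    case (Suc k)
    then obtain t where t: "i \<le> t" "t < j" "?f (i + k) = ?f t"
      by blast
    then have "?f t \<notin> right_special s n"
      using ij by (intro nonspecial) auto
    then have eq: "?f (i + Suc k) = ?f (Suc t)"
      using right_special_step(2)[OF st t(3)[symmetric]] by simp
    show ?case
    proof (cases "Suc t = j")
      case True
      then show ?thesis
        using eq ij by (intro exI[of _ i]) simp
    next
      case False
      then show ?thesis
        using eq t by (intro exI[of _ "Suc t"]) simp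
    qed
  qed
  have nonspecial': "?f (i + k) \<notin> right_special s n" for k
  proof -
    obtain t where "i \<le> t" "t < j" "?f (i + k) = ?f t"
      using orbit by blast
    then show ?thesis
      using nonspecial[of t] ij by simp
  qed
  have per: "?f (i + k) = ?f (j + k)" for k
  proof (induction k)
    case (Suc k)
    then show ?case
      using right_special_step(2)[OF st Suc nonspecial'] by simp
  qed (use ij in simp)
  then have "s (i + k) = s (j + k)" for k
  proof -
    have "\<forall>x<n. s (i + k + x) = s (j + k + x)"
      using per[of k] unfolding window_eq_iff .
    then show ?thesis
      using \<open>n > 0\<close> by (metis add.right_neutral)
  qed
  then show False
    using not_eventually_periodic[OF st ij(1)] by blast
qed

text \<open>In a shortest unbalanced pair 1w1, 0w0 the common w is right special, so the right
  special word of length \<open>L + 1\<close> is zw for a letter z. It would have to start at one of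
  the \<open>L + 2\<close> positions of the copy whose end letters differ from z, which the
  palindrome w prevents.\<close>

theorem sturmian_balanced:
  assumes st: "sturmian s"
  shows "ones s t n \<le> ones s t' n + 1"
proof (rule ccontr)
  assume "\<not> ?thesis"
  then have ex: "\<exists>n t t'. ones s t n \<ge> ones s t' n + 2"
    by (intro exI[of _ n] exI[of _ t] exI[of _ t']) simp
  define n where "n = (LEAST n. \<exists>t t'. ones s t n \<ge> ones s t' n + 2)"
  obtain a b where ab: "ones s a n \<ge> ones s b n + 2"
    using LeastI_ex[OF ex] by (auto simp: n_def)
  have min: "ones s t k \<le> ones s t' k + 1" if "k < n" for k t t'
    using not_less_Least[OF that[unfolded n_def]] by (auto simp: not_le less_Suc_eq_le)
  obtain L where ends: "s a = 1" "s b = 0" "s (a + L + 1) = 1" "s (b + L + 1) = 0"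
    and eq: "\<And>k. k < L \<Longrightarrow> s (a + 1 + k) = s (b + 1 + k)"
    and pal: "\<And>k. k < L \<Longrightarrow> s (a + 1 + k) = s (a + 1 + (L - 1 - k))"
    using minimal_unbalanced[OF st ab min] by metis
  have W: "window s (a + 1) L \<in> right_special s L"
    using right_specialI[OF st, of "a + 1" L "b + 1"] eq ends by (simp add: window_eq_iff)
  obtain r where r: "r \<in> right_special s (Suc L)"
    using card_right_special[OF st, of "Suc L"] by (metis card_1_singletonE singletonI)
  obtain z where z: "r = z # window s (a + 1) L"
    using right_special_tl[OF st r] right_special_unique[OF st W] by metis
  obtain c where c: "s c \<noteq> z" "s (c + L + 1) = s c"
    and ceq: "\<And>k. k < L \<Longrightarrow> s (c + 1 + k) = s (a + 1 + k)"
    using that[of a] that[of b] ends eq by (cases "z = 0") auto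
  \<comment> \<open>The palindrome between the two equal letters s c and s (c + L + 1) \<noteq> z keeps r from starting there.\<close>
  have "window s (c + t) (Suc L) \<noteq> r" if t: "t \<le> Suc L" for t
  proof
    assume "window s (c + t) (Suc L) = r"
    then have hd: "s (c + t) = z" and "window s (c + t + 1) L = window s (a + 1) L"
      by (simp_all add: z window_Suc_Cons)
    then have tail: "s (c + t + 1 + k) = s (a + 1 + k)" if "k < L" for k
      using that by (simp add: window_eq_iff)
    have "t \<noteq> 0" "t \<noteq> Suc L"
      using hd c by (auto intro: ccontr)
    then obtain u where u: "t = Suc u" "u < L"
      using t by (cases t) auto
    have "s (c + L + 1) = s (c + t + 1 + (L - t))"
      using u by simp
    also have "\<dots> = s (a + 1 + (L - 1 - u))"
      using tail[of "L - t"] u by simp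
    also have "\<dots> = s (c + 1 + u)"
      using pal[of u] ceq[of u] u by simp
    also have "\<dots> = z"
      using hd u by simp
    finally show False
      using c by simp
  qed
  then show False
    using right_special_recurrent[OF st _ r, of c] by blast
qed

subsection \<open>Closed-rich words and bounded runs\<close>

text \<open>\<open>R\<close> counts the equal pairs at distance \<open>q\<close>, so the periodic
  stretch itself has \<open>R + q\<close> letters. The condition says that the exponents of
  repetitions in \<open>s\<close> are bounded.\<close>

definition bounded_runs :: "(nat \<Rightarrow> 'a) \<Rightarrow> nat \<Rightarrow> bool" where
  "bounded_runs s K \<longleftrightarrow>
    (\<forall>q>0. \<forall>t R. (\<forall>x<R. s (t + x + q) = s (t + x)) \<longrightarrow> R \<le> K * q)"

lemma bounded_runsD:
  assumes "bounded_runs s K" "q > 0" "\<And>x. x < R \<Longrightarrow> s (t + x + q) = s (t + x)"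
  shows "R \<le> K * q"
  using assms unfolding bounded_runs_def by blast

lemma periodic_mod:
  fixes s :: "nat \<Rightarrow> 'a"
  assumes "q > 0" and per: "\<And>x. x < R \<Longrightarrow> s (t + x + q) = s (t + x)" and "x < R + q"
  shows "s (t + x) = s (t + x mod q)"
  using assms(3)
proof (induction x rule: less_induct)
  case (less x)
  show ?case
  proof (cases "x < q")
    case False
    then have "s (t + x) = s (t + (x - q))"
      using per[of "x - q"] less.prems by simp
    then show ?thesis
      using less.IH[of "x - q"] less.prems False \<open>q > 0\<close> by (simp add: le_mod_geq)
  qed simp
qed

text \<open>Inside a run of period \<open>q\<close> a factor is determined by its length and its
  start modulo \<open>q\<close>. This allows too few distinct factors, closed or not.\<close>

lemma closed_rich_imp_bounded_runs:
  assumes "closed_rich s"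
  shows "\<exists>K. bounded_runs s K"
proof -
  obtain C :: real where C: "C > 0"
    and rich: "\<And>n v. v \<in> factors_of_length s n \<Longrightarrow>
      real (card {u. sublist u v \<and> closed_word u}) \<ge> C * (real n)\<^sup>2"
    using assms unfolding closed_rich_def by blast
  \<comment> \<open>With \<open>n = K * q\<close> there are at most
    \<open>q * (n + 1) \<le> 2 * q * n\<close> factors, while richness demands
    \<open>C * K * q * n\<close>; hence the threshold 2.\<close>
  obtain K where K: "2 < real K * C"
    using reals_Archimedean3[OF C] by blast
  have "R \<le> K * q" if "q > 0" and per: "\<And>x. x < R \<Longrightarrow> s (t + x + q) = s (t + x)" for q t R
  proof (rule ccontr)
    assume "\<not> R \<le> K * q"
    define n where "n = K * q"
    let ?v = "window s t n"
    have "{u. sublist u ?v \<and> closed_word u} \<subseteq> (\<lambda>(i, l). window s (t + i) l) ` ({..<q} \<times> {..n})"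
    proof clarify
      fix u assume "sublist u ?v"
      then obtain i l where il: "i + l \<le> n" "u = window s (t + i) l"
        by (auto simp: sublist_window_iff)
      have "window s (t + i) l = window s (t + i mod q) l"
        unfolding window_eq_iff
      proof clarify
        fix y assume "y < l"
        have "i mod q < q"
          using \<open>q > 0\<close> by simp
        then have lt: "i + y < R + q" "i mod q + y < R + q"
          using il \<open>y < l\<close> \<open>\<not> R \<le> K * q\<close> by (simp_all add: n_def)
        have "s (t + (i + y)) = s (t + (i + y) mod q)"
          by (rule periodic_mod[OF that(1) per lt(1)])
        also have "\<dots> = s (t + (i mod q + y) mod q)"
          by (simp add: mod_add_left_eq)
        also have "\<dots> = s (t + (i mod q + y))"
          by (rule periodic_mod[OF that(1) per lt(2), symmetric])
        finally show "s (t + i + y) = s (t + i mod q + y)"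
          by (simp add: add.assoc)
      qed
      then show "u \<in> (\<lambda>(i, l). window s (t + i) l) ` ({..<q} \<times> {..n})"
        using il \<open>q > 0\<close> by (intro image_eqI[of _ _ "(i mod q, l)"]) auto
    qed
    then have "card {u. sublist u ?v \<and> closed_word u} \<le> card ({..<q} \<times> {..n})"
      by (intro surj_card_le) auto
    then have "card {u. sublist u ?v \<and> closed_word u} \<le> q * (n + 1)"
      by simp
    moreover have "C * (real n)\<^sup>2 \<le> real (card {u. sublist u ?v \<and> closed_word u})"
      by (rule rich) (simp add: factors_of_length_eq)
    ultimately have "C * (real n)\<^sup>2 \<le> real (q * (n + 1))"
      by (meson of_nat_le_iff order_trans)
    also have "q * (n + 1) \<le> q * (2 * n)"
      using K \<open>q > 0\<close> by (cases "K = 0") (auto simp: n_def)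
    finally have "C * (real n)\<^sup>2 \<le> real q * (2 * real n)"
      by simp
    moreover have "real n > 0"
      using K \<open>q > 0\<close> by (cases "K = 0") (auto simp: n_def)
    ultimately have "C * real n \<le> real q * 2"
      by (simp add: power2_eq_square)
    then have "(C * real K) * real q \<le> 2 * real q"
      by (simp add: n_def mult_ac)
    then show False
      using K \<open>q > 0\<close> by (simp add: mult.commute)
  qed
  then show ?thesis
    unfolding bounded_runs_def by blast
qed

section \<open>Closed factors as complete returns\<close>

lemma border_window_iff:
  "border u (window s i n) \<longleftrightarrow>
    (\<exists>k<n. u = window s i k \<and> window s (i + (n - k)) k = window s i k)"
proof
  assume b: "border u (window s i n)"
  define k where "k = length u"
  have k: "k < n"
    using b prefix_length_less unfolding border_def k_def by force
  have "u = take k (window s i n)"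
    using b unfolding border_def strict_prefix_def k_def
    by (metis append_eq_conv_conj prefixE)
  then have 1: "u = window s i k"
    using take_drop_window[of 0 k n s i] k by simp
  have "u = drop (n - k) (window s i n)"
  proof -
    obtain zs where zs: "window s i n = zs @ u"
      using b unfolding border_def suffix_def by blast
    then have "n = length zs + k"
      by (metis k_def length_append length_window)
    then have "n - k = length zs"
      by simp
    then show ?thesis
      by (simp add: zs)
  qed
  then have "u = take k (drop (n - k) (window s i n))"
    using k by simp
  then have "u = window s (i + (n - k)) k"
    using take_drop_window[of "n - k" k n s i] k by simp
  then show "\<exists>k<n. u = window s i k \<and> window s (i + (n - k)) k = window s i k"
    using 1 k by auto
next
  assume "\<exists>k<n. u = window s i k \<and> window s (i + (n - k)) k = window s i k"
  then obtain k where k: "k < n" "u = window s i k" "u = window s (i + (n - k)) k"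
    by auto
  have "u = take k (window s i n)"
    using take_drop_window[of 0 k n s i] k by simp
  moreover have "u = drop (n - k) (window s i n)"
    using take_drop_window[of "n - k" k n s i] k by simp
  moreover have "u \<noteq> window s i n"
    using k by (metis length_window less_irrefl)
  ultimately show "border u (window s i n)"
    by (metis border_def strict_prefix_def suffix_drop take_is_prefix)
qed

lemma complete_return_closed:
  assumes "k > 0" "i < i'" "window s i' k = window s i k"
  shows "\<exists>j. i < j \<and> j \<le> i' \<and> longest_border (window s i k) (window s i (j - i + k)) \<and>
    closed_word (window s i (j - i + k))"
proof -
  define j where "j = (LEAST j. i < j \<and> window s j k = window s i k)"
  have j: "i < j" "window s j k = window s i k" "j \<le> i'"
    using LeastI[of "\<lambda>j. i < j \<and> window s j k = window s i k" i']
      Least_le[of "\<lambda>j. i < j \<and> window s j k = window s i k" i'] assms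
    by (simp_all add: j_def)
  have min: "window s p k \<noteq> window s i k" if "i < p" "p < j" for p
    using not_less_Least[OF that(2)[unfolded j_def]] that(1) by auto
  define n where "n = j - i + k"
  have n: "k < n" "i + (n - k) = j"
    using j by (auto simp: n_def)
  have "border (window s i k) (window s i n)"
    using n j by (auto simp: border_window_iff)
  \<comment> \<open>A longer border would place a copy of the window of length \<open>k\<close>
    strictly between \<open>i\<close> and \<open>j\<close>, against the choice of \<open>j\<close>
    as the first return.\<close>
  moreover have "length u' \<le> k" if b: "border u' (window s i n)" for u'
  proof (rule ccontr)
    assume "\<not> length u' \<le> k"
    then obtain k' where k': "k < k'" "k' < n" "window s (i + (n - k')) k' = window s i k'"
      using b unfolding border_window_iff by (metis length_window not_le)
    then have "window s (i + (n - k')) k = window s i k"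
      by (simp add: window_eq_iff)
    then show False
      using min[of "i + (n - k')"] k' by (simp add: n_def)
  qed
  ultimately have lb: "longest_border (window s i k) (window s i n)"
    by (auto simp: longest_border_def)
  have "occurrences (window s i k) (window s i n) = {0, j - i}"
  proof (intro equalityI subsetI)
    fix p assume "p \<in> occurrences (window s i k) (window s i n)"
    then have p: "p + k \<le> n" "window s (i + p) k = window s i k"
      by (auto simp: occurrences_def take_drop_window)
    have "p = 0 \<or> \<not> i + p < j"
      using min[of "i + p"] p(2) by auto
    then show "p \<in> {0, j - i}"
      using p(1) by (auto simp: n_def)
  next
    fix p assume "p \<in> {0, j - i}"
    then have "p + k \<le> n" "window s (i + p) k = window s i k"
      using j(1,2) by (auto simp: n_def)
    then show "p \<in> occurrences (window s i k) (window s i n)"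
      by (simp add: occurrences_def take_drop_window)
  qed
  then have "card (occurrences (window s i k) (window s i n)) = 2"
    using j(1) by simp
  moreover have "window s i k \<noteq> []"
    using \<open>k > 0\<close> by (cases k) (simp_all add: window_Suc)
  ultimately have "closed_word (window s i n)"
    using lb by (auto simp: closed_word_def)
  then show ?thesis
    using j lb by (auto simp: n_def)
qed

text \<open>A local Morse-Hedlund argument. If \<open>u\<close> is missing, the number of factors of
  length \<open>j\<close> seen at the starts in \<open>T\<close> cannot grow at every step from 1 to
  \<open>k + 1\<close>. At a length where it stalls, each factor seen has a single right extension,
  and a repeated factor then forces a run longer than allowed.\<close>

lemma bounded_runs_recurrent:
  assumes st: "sturmian s" and br: "bounded_runs s K" and k: "k > 0"
    and u: "u \<in> factors_of_length s k"
  shows "\<exists>t. a \<le> t \<and> t + k \<le> a + (K + 2) * k \<and> window s t k = u"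
proof (rule ccontr)
  assume "\<not> ?thesis"
  then have avoid: "window s t k \<noteq> u" if "a \<le> t" "t \<le> a + (K + 1) * k" for t
    using that by auto
  define T where "T = {a..a + (K + 1) * k}"
  define A where "A j = (\<lambda>t. window s t j) ` T" for j
  have sub: "A j \<subseteq> factors_of_length s j" for j
    by (auto simp: A_def factors_of_length_eq)
  have "A k \<subseteq> factors_of_length s k - {u}"
  proof
    fix x assume x: "x \<in> A k"
    then obtain t where "a \<le> t" "t \<le> a + (K + 1) * k" "x = window s t k"
      by (auto simp: A_def T_def)
    then have "x \<noteq> u"
      using avoid by blast
    then show "x \<in> factors_of_length s k - {u}"
      using x sub by blast
  qed
  then have "card (A k) \<le> card (factors_of_length s k - {u})"
    by (intro card_mono) (auto simp: finite_factors[OF st])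
  then have card_k: "card (A k) \<le> k"
    using u by (simp add: card_factors[OF st])
  have "\<exists>j<k. card (A (Suc j)) \<le> card (A j)"
  proof (rule ccontr)
    assume "\<not> ?thesis"
    then have inc: "card (A j) < card (A (Suc j))" if "j < k" for j
      using that by auto
    have "j \<le> k \<Longrightarrow> j + 1 \<le> card (A j)" for j
    proof (induction j)
      case 0
      then show ?case
        by (auto simp: A_def T_def image_constant_conv)
    next
      case (Suc j)
      then show ?case
        using inc[of j] by simp
    qed
    then show False
      using card_k by fastforce
  qed
  then obtain j where j: "j < k" "card (A (Suc j)) \<le> card (A j)"
    by blast
  have but: "butlast ` A (Suc j) = A j"
    by (simp add: A_def image_image window_Suc)
  have finA: "finite (A i)" for i
    by (simp add: A_def T_def)
  \<comment> \<open>Deleting the last letter maps \<open>A (Suc j)\<close> onto the at least as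
    large set \<open>A j\<close>, so it is injective: on \<open>T\<close>, the next letter is a
    function of the preceding \<open>j\<close>.\<close>
  have "inj_on butlast (A (Suc j))"
    using j card_image_le[OF finA, of butlast "Suc j"] by (intro eq_card_imp_inj_on finA) (simp add: but)
  then have det: "window s x (Suc j) = window s y (Suc j)"
    if "x \<in> T" "y \<in> T" "window s x j = window s y j" for x y
  proof (rule inj_onD)
    show "butlast (window s x (Suc j)) = butlast (window s y (Suc j))"
      using that(3) by (simp add: window_Suc)
    show "window s x (Suc j) \<in> A (Suc j)" "window s y (Suc j) \<in> A (Suc j)"
      using that(1,2) by (simp_all add: A_def)
  qed
  have kT: "a + k \<le> a + (K + 1) * k"
    by simp
  \<comment> \<open>The \<open>k + 1\<close> earliest starts meet at most
    \<open>j + 1 \<le> k\<close> factors of length \<open>j\<close>, so a repetition occurs with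
    distance at most \<open>k\<close> and most of \<open>T\<close> still ahead.\<close>
  have "(\<lambda>t. window s t j) ` {a..a + k} \<subseteq> factors_of_length s j"
    by (auto simp: factors_of_length_eq)
  then have "card ((\<lambda>t. window s t j) ` {a..a + k}) \<le> j + 1"
    using card_mono[OF finite_factors[OF st]] by (fastforce simp: card_factors[OF st])
  then have "\<not> inj_on (\<lambda>t. window s t j) {a..a + k}"
    using j by (intro pigeonhole) simp
  then obtain t1 t2 where t: "t1 < t2" "a \<le> t1" "t2 \<le> a + k" "window s t1 j = window s t2 j"
    using not_inj_on_less[of "\<lambda>t. window s t j" "{a..a + k}"] by auto
  have eq: "window s (t1 + x) j = window s (t2 + x) j" if "t2 + x \<le> a + (K + 1) * k" for x
    using that
  proof (induction x)
    case (Suc x)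
    then have "window s (t1 + x) (Suc j) = window s (t2 + x) (Suc j)"
      using t by (intro det) (auto simp: T_def)
    then show ?case
      by (simp add: window_Suc_Cons)
  qed (use t in simp)
  have run: "s (t1 + x + (t2 - t1)) = s (t1 + x)" if "x < a + (K + 1) * k - t2 + 1" for x
  proof -
    have x: "t2 + x \<le> a + (K + 1) * k"
      using that t kT by linarith
    then have "window s (t1 + x) (Suc j) = window s (t2 + x) (Suc j)"
      using t by (intro det eq) (auto simp: T_def)
    then have "s (t1 + x) = s (t2 + x)"
      by (simp add: window_Suc_Cons)
    moreover have "t1 + x + (t2 - t1) = t2 + x"
      using t(1) by linarith
    ultimately show ?thesis
      by metis
  qed
  \<comment> \<open>Since \<open>t2 \<le> a + k\<close>, the left side is at least
    \<open>K * k + 1\<close>, whereas the right side is at most \<open>K * k\<close>.\<close>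
  have "a + (K + 1) * k - t2 + 1 \<le> K * (t2 - t1)"
    by (rule bounded_runsD[OF br _ run]) (use t in simp)
  also have "\<dots> \<le> K * k"
    using t by (intro mult_left_mono) auto
  finally show False
    using t by simp
qed

text \<open>Every factor of length at most \<open>h\<close> has a complete return inside
  \<open>v\<close>. The return is closed and its longest border gives the factor back, so distinct
  factors yield distinct closed words; summing \<open>k + 1\<close> over the lengths gives quadratic
  growth.\<close>

lemma bounded_runs_imp_closed_rich:
  assumes st: "sturmian s" and br: "bounded_runs s K"
  shows "closed_rich s"
proof -
  define c where "c = K + 2"
  have c: "c > 0"
    by (simp add: c_def)
  have bound: "real (card {u. sublist u v \<and> closed_word u}) \<ge> 1 / (8 * (real c)\<^sup>2) * (real n)\<^sup>2"
    if v_in: "v \<in> factors_of_length s n" for n v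
  proof -
    obtain a where v: "v = window s a n"
      using v_in by (auto simp: factors_of_length_eq)
    define Z where "Z = {u. sublist u v \<and> closed_word u}"
    \<comment> \<open>For \<open>k \<le> h\<close> two adjacent blocks of length
      \<open>c * k\<close> fit into \<open>v\<close>, and each contains every factor of length
      \<open>k\<close>.\<close>
    define h where "h = n div (2 * c)"
    define G where "G = (\<Union>k\<in>{1..h}. factors_of_length s k)"
    have len: "length u = k" if "u \<in> factors_of_length s k" for u k
      using that by (auto simp: factors_of_length_eq)
    have "finite {u. sublist u v}"
      using finite_set[of "sublists v"] by (simp add: set_sublists_eq)
    then have finZ: "finite Z"
      by (simp add: Z_def)
    have ex: "\<exists>z\<in>Z. longest_border u z" if u_in: "u \<in> G" for u
    proof -
      obtain k where k: "1 \<le> k" "k \<le> h" "u \<in> factors_of_length s k"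
        using u_in by (auto simp: G_def)
      have "2 * c * k \<le> 2 * c * h"
        using k by simp
      also have "\<dots> \<le> n"
        by (simp add: h_def)
      finally have n: "c * k + c * k \<le> n"
        by simp
      obtain i where i: "a \<le> i" "i + k \<le> a + c * k" "window s i k = u"
        using bounded_runs_recurrent[OF st br _ k(3), of a] k(1) by (auto simp: c_def)
      obtain i' where i': "a + c * k \<le> i'" "i' + k \<le> a + c * k + c * k" "window s i' k = u"
        using bounded_runs_recurrent[OF st br _ k(3), of "a + c * k"] k(1) by (auto simp: c_def)
      have "i < i'"
        using i i' k by linarith
      then obtain j where j: "i < j" "j \<le> i'" "longest_border u (window s i (j - i + k))"
        "closed_word (window s i (j - i + k))"
        using complete_return_closed[of k i i' s] i i' k by auto
      moreover have "sublist (window s i (j - i + k)) v"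
        unfolding v sublist_window_iff
        using i i' j n by (intro exI[of _ "i - a"] exI[of _ "j - i + k"]) auto
      ultimately show ?thesis
        by (auto simp: Z_def)
    qed
    then obtain z where z: "\<And>u. u \<in> G \<Longrightarrow> z u \<in> Z" "\<And>u. u \<in> G \<Longrightarrow> longest_border u (z u)"
      by metis
    have "inj_on z G"
    proof (rule inj_onI)
      fix u u' assume *: "u \<in> G" "u' \<in> G" "z u = z u'"
      then have "longest_border u (z u)" "longest_border u' (z u)"
        using z by metis+
      then have "length u = length u'" "prefix u (z u)" "prefix u' (z u)"
        by (auto simp: longest_border_def border_def intro: order_antisym)
      then show "u = u'"
        by (metis append_eq_append_conv prefixE)
    qed
    \<comment> \<open>The empty word is an additional closed factor. It keeps the estimate valid for
      \<open>n < 2 * c\<close>, where \<open>h = 0\<close> and \<open>G\<close> is empty.\<close>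
    moreover have "[] \<notin> z ` G"
      using z(2) by (fastforce simp: longest_border_def border_def)
    moreover have "insert [] (z ` G) \<subseteq> Z"
      using z(1) by (auto simp: Z_def closed_word_def)
    moreover have finG: "finite G"
      by (auto simp: G_def finite_factors[OF st])
    ultimately have "card G + 1 \<le> card Z"
      using card_mono[OF finZ, of "insert [] (z ` G)"] by (simp add: card_image)
    moreover have "card G = (\<Sum>k\<in>{1..h}. k + 1)"
      unfolding G_def
      by (subst card_UN_disjoint) (auto simp: finite_factors[OF st] card_factors[OF st] dest: len)
    moreover have "(h + 1)\<^sup>2 \<le> 2 * ((\<Sum>k\<in>{1..h}. k + 1) + 1)"
      by (induction h) (auto simp: power2_eq_square)
    ultimately have "(h + 1)\<^sup>2 \<le> 2 * card Z"
      by simp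
    moreover have "n \<le> 2 * c * (h + 1)"
      using dividend_less_times_div[of "2 * c" n] c by (simp add: h_def)
    then have "n\<^sup>2 \<le> (2 * c * (h + 1))\<^sup>2"
      by (rule power_mono) simp
    then have "n\<^sup>2 \<le> 4 * c\<^sup>2 * (h + 1)\<^sup>2"
      unfolding power_mult_distrib by simp
    ultimately have "n\<^sup>2 \<le> 4 * c\<^sup>2 * (2 * card Z)"
      by (meson le_trans mult_le_mono2)
    then have "real (n\<^sup>2) \<le> real (4 * c\<^sup>2 * (2 * card Z))"
      by (simp only: of_nat_le_iff)
    then have "(real n)\<^sup>2 \<le> 8 * (real c)\<^sup>2 * real (card Z)"
      by simp
    then show ?thesis
      using c by (simp add: Z_def field_simps)
  qed
  show ?thesis
    unfolding closed_rich_def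
    using bound c by (intro exI[of _ "1 / (8 * (real c)\<^sup>2)"]) auto
qed

subsection \<open>The discrepancy\<close>

text \<open>Cut the prefix into \<open>j\<close> blocks of length \<open>n\<close>; by balance each
  block deviates by at most 1 from the window at \<open>t\<close>.\<close>

lemma ones_multiple:
  assumes "sturmian s"
  shows "\<bar>real (ones s 0 (j * n)) - real j * real (ones s t n)\<bar> \<le> real j"
proof (induction j)
  case (Suc j)
  have "ones s 0 (Suc j * n) = ones s 0 (j * n) + ones s (j * n) n"
    using ones_add[of s 0 "j * n" n] by (simp add: add.commute)
  moreover have "\<bar>real (ones s (j * n) n) - real (ones s t n)\<bar> \<le> 1"
    using sturmian_balanced[OF assms, of "j * n" n t] sturmian_balanced[OF assms, of t n "j * n"]
    by linarith
  ultimately show ?case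
    using Suc by (simp add: algebra_simps)
qed (simp add: ones_def)

text \<open>\<open>slope\<close> is defined through \<open>lim\<close>, so convergence has to be
  established. Comparing the frequencies at \<open>n\<close> and \<open>m\<close> with that at
  \<open>m * n\<close> yields the Cauchy estimate \<open>1 / n + 1 / m\<close>.\<close>

lemma slope_LIMSEQ:
  assumes st: "sturmian s"
  shows "(\<lambda>n. real (ones s 0 n) / real n) \<longlonglongrightarrow> slope s"
proof -
  let ?f = "\<lambda>n. real (ones s 0 n) / real n"
  have dist: "\<bar>?f n - ?f m\<bar> \<le> 1 / real n + 1 / real m" if "n > 0" "m > 0" for m n
  proof -
    have "\<bar>real m * real (ones s 0 n) - real n * real (ones s 0 m)\<bar> \<le> real m + real n"
      using ones_multiple[OF st, of m n 0] ones_multiple[OF st, of n m 0] by (simp add: mult.commute)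
    moreover have "?f n - ?f m = (real m * real (ones s 0 n) - real n * real (ones s 0 m)) / (real n * real m)"
      using that by (simp add: field_simps)
    moreover have "1 / real n + 1 / real m = (real m + real n) / (real n * real m)"
      using that by (simp add: field_simps)
    ultimately show ?thesis
      using that by (simp add: divide_right_mono)
  qed
  have "Cauchy ?f"
  proof (rule CauchyI)
    fix e :: real assume "e > 0"
    then obtain N where N: "1 / real (Suc N) < e / 2"
      using reals_Archimedean[of "e / 2"] by (auto simp: inverse_eq_divide)
    have "\<bar>?f n - ?f m\<bar> < e" if "n \<ge> Suc N" "m \<ge> Suc N" for m n
    proof -
      have "1 / real n \<le> 1 / real (Suc N)" "1 / real m \<le> 1 / real (Suc N)"
        using that by (intro divide_left_mono; simp)+
      then show ?thesis
        using dist[of n m] that N by linarith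
    qed
    then show "\<exists>M. \<forall>m\<ge>M. \<forall>n\<ge>M. norm (?f m - ?f n) < e"
      by (metis real_norm_def)
  qed
  then have "?f \<longlonglongrightarrow> lim ?f"
    by (simp add: Cauchy_convergent_iff convergent_LIMSEQ_iff)
  moreover have "ones s 0 n = card {i. i < n \<and> s i = 1}" for n
  proof -
    have "ones s 0 n = (\<Sum>i<n. if s i = 1 then 1 else 0)"
      unfolding ones_def using binary[OF st] by (intro sum.cong) fastforce+
    also have "\<dots> = card {i. i < n \<and> s i = 1}"
      by (simp add: sum.If_cases Int_def)
    finally show ?thesis .
  qed
  ultimately show ?thesis
    by (simp add: slope_def letter_frequency_def)
qed

text \<open>The frequencies at the multiples of \<open>n\<close> all lie within \<open>1 / n\<close>
  of that of the given window, and they converge to the slope.\<close>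

lemma ones_near_slope:
  assumes st: "sturmian s"
  shows "\<bar>real (ones s t n) - real n * slope s\<bar> \<le> 1"
proof (cases "n = 0")
  case False
  let ?f = "\<lambda>n. real (ones s 0 n) / real n"
  have "(\<lambda>j. ?f (j * n)) \<longlonglongrightarrow> slope s"
    using filterlim_compose[OF slope_LIMSEQ[OF st] mult_nat_right_at_top[of n]] False by simp
  then have lim: "(\<lambda>j. \<bar>?f (j * n) - real (ones s t n) / real n\<bar>) \<longlonglongrightarrow> \<bar>slope s - real (ones s t n) / real n\<bar>"
    by (intro tendsto_intros)
  have "\<bar>?f (j * n) - real (ones s t n) / real n\<bar> \<le> 1 / real n" if "j \<ge> 1" for j
  proof -
    have "?f (j * n) - real (ones s t n) / real n
      = (real (ones s 0 (j * n)) - real j * real (ones s t n)) / (real j * real n)"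
      using that False by (simp add: field_simps)
    also have "\<bar>\<dots>\<bar> \<le> real j / (real j * real n)"
      unfolding abs_divide abs_mult abs_of_nat
      by (intro divide_right_mono ones_multiple[OF st]) simp
    also have "\<dots> = 1 / real n"
      using that by simp
    finally show ?thesis .
  qed
  then have "\<bar>slope s - real (ones s t n) / real n\<bar> \<le> 1 / real n"
    by (intro LIMSEQ_le_const2[OF lim] exI[of _ 1]) blast
  then have "real n * \<bar>slope s - real (ones s t n) / real n\<bar> \<le> 1"
    using False by (simp add: field_simps)
  moreover have "real n * \<bar>slope s - real (ones s t n) / real n\<bar> = \<bar>real n * slope s - real (ones s t n)\<bar>"
    using False by (simp add: abs_mult_pos' right_diff_distrib)
  ultimately show ?thesis
    by linarith
qed (simp add: ones_def)

text \<open>Keeps just two features of \<open>disc s\<close>: oscillation at most 1, and motion as a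
  rotation by \<open>- \<alpha>\<close> modulo 1. This class is closed under negating both \<alpha>
  and \<open>D\<close>, so estimates can be proved for positive \<epsilon> and then
  reflected.\<close>

definition discrepancy :: "real \<Rightarrow> (nat \<Rightarrow> real) \<Rightarrow> bool" where
  "discrepancy \<alpha> D \<longleftrightarrow> (\<forall>a b. \<bar>D a - D b\<bar> \<le> 1) \<and> (\<forall>a. D (Suc a) - D a + \<alpha> \<in> \<int>)"

lemma discrepancy_minus: "discrepancy \<alpha> D \<Longrightarrow> discrepancy (- \<alpha>) (\<lambda>x. - D x)"
proof -
  assume "discrepancy \<alpha> D"
  then have "\<bar>D b - D a\<bar> \<le> 1" "- (D (Suc a) - D a + \<alpha>) \<in> \<int>" for a b
    unfolding discrepancy_def by (blast intro: Ints_minus)+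
  moreover have "- D (Suc a) - - D a + - \<alpha> = - (D (Suc a) - D a + \<alpha>)" "- D a - - D b = D b - D a" for a b
    by simp_all
  ultimately show ?thesis
    unfolding discrepancy_def by metis
qed

lemma discrepancy_bound: "discrepancy \<alpha> D \<Longrightarrow> \<bar>D a - D b\<bar> \<le> 1"
  by (simp add: discrepancy_def)

text \<open>The integer \<open>p\<close> is arbitrary, so the numerator of any approximation can be
  inserted; what remains is to identify \<open>j\<close> from the bound on the oscillation.\<close>

lemma discrepancy_step:
  assumes "discrepancy \<alpha> D"
  obtains j :: int where "D (a + q) = D a - (real q * \<alpha> - of_int p) + of_int j"
proof -
  have "D (a + q) - D a + real q * \<alpha> \<in> \<int>"
  proof (induction q)
    case (Suc q)
    have "D (Suc (a + q)) - D (a + q) + \<alpha> \<in> \<int>"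
      using assms by (simp add: discrepancy_def)
    from Ints_add[OF Suc this] show ?case
      by (simp add: algebra_simps)
  qed simp
  then obtain i where "D (a + q) - D a + real q * \<alpha> = of_int i"
    by (auto elim: Ints_cases)
  then show thesis
    using that[of "i - p"] by simp
qed

definition disc :: "(nat \<Rightarrow> nat) \<Rightarrow> nat \<Rightarrow> real" where
  "disc s t = real (ones s 0 t) - real t * slope s"

lemma disc_diff: "disc s (t + n) - disc s t = real (ones s t n) - real n * slope s"
  using ones_add[of s 0 t n] by (simp add: disc_def algebra_simps)

lemma discrepancy_disc:
  assumes "sturmian s"
  shows "discrepancy (slope s) (disc s)"
  unfolding discrepancy_def
proof (intro conjI allI)
  fix a b
  have "\<bar>disc s (a + n) - disc s a\<bar> \<le> 1" for a n
    using ones_near_slope[OF assms] by (simp add: disc_diff)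
  from this[of a "b - a"] this[of b "a - b"] show "\<bar>disc s a - disc s b\<bar> \<le> 1"
    by (cases "a \<le> b") (auto simp: abs_minus_commute)
next
  fix a
  show "disc s (Suc a) - disc s a + slope s \<in> \<int>"
    using disc_diff[of s a 1] by simp
qed

text \<open>A shift by \<open>q\<close> changes \<open>D\<close> by - \<epsilon> or by 1 -
  \<epsilon>, and the sum \<open>U\<close> of \<open>q\<close> consecutive values of
  \<open>D\<close> telescopes these changes. If each \<open>L\<close> consecutive starts included a
  change of the second kind, \<open>U\<close> would gain at least
  \<open>1 - L * \<epsilon> > 0\<close> every \<open>L\<close> steps, although it stays within
  \<open>q\<close> of its initial value.\<close>

lemma discrepancy_long_run_pos:
  assumes D: "discrepancy \<alpha> D"
    and eps: "\<epsilon> = real q * \<alpha> - of_int p" "0 < \<epsilon>" "real L * \<epsilon> < 1"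
  shows "\<exists>t. \<forall>x<L. D (t + x + q) = D (t + x) - \<epsilon>"
proof (rule ccontr)
  assume "\<not> ?thesis"
  then have ex: "\<exists>x<L. D (t + x + q) \<noteq> D (t + x) - \<epsilon>" for t
    by blast
  have "L \<ge> 1"
    using ex[of 0] by auto
  then have "1 * \<epsilon> \<le> real L * \<epsilon>"
    using eps(2) by (intro mult_right_mono) auto
  then have "\<epsilon> < 1"
    using eps(3) by linarith
  have step: "D (n + q) = D n - \<epsilon> \<or> D (n + q) = D n - \<epsilon> + 1" for n
  proof -
    obtain j where j: "D (n + q) = D n - \<epsilon> + of_int j"
      using discrepancy_step[OF D, of n q p] eps(1) by metis
    have "\<bar>D (n + q) - D n\<bar> \<le> 1"
      by (rule discrepancy_bound[OF D])
    then have "- 1 < real_of_int j" "real_of_int j < 2"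
      using j \<open>0 < \<epsilon>\<close> \<open>\<epsilon> < 1\<close> by linarith+
    then have "j = 0 \<or> j = 1"
      by linarith
    then show ?thesis
      using j by auto
  qed
  define U where "U n = (\<Sum>i<q. D (n + i))" for n
  have U_step: "U (Suc n) - U n = D (n + q) - D n" for n
    using sum.lessThan_Suc[of "\<lambda>i. D (n + i)" q] sum.lessThan_Suc_shift[of "\<lambda>i. D (n + i)" q]
    by (simp add: U_def)
  have U_window: "U (t + L) - U t \<ge> 1 - real L * \<epsilon>" for t
  proof -
    obtain x0 where x0: "x0 < L" "D (t + x0 + q) = D (t + x0) - \<epsilon> + 1"
      using ex[of t] step by blast
    have "U (t + L) - U t = (\<Sum>x<L. U (Suc (t + x)) - U (t + x))"
      using sum_lessThan_telescope[of "\<lambda>x. U (t + x)" L] by simp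
    also have "\<dots> = (\<Sum>x<L. D (t + x + q) - D (t + x))"
      by (simp only: U_step)
    also have "\<dots> \<ge> (\<Sum>x<L. (if x = x0 then 1 else 0) - \<epsilon>)"
    proof (rule sum_mono)
      fix x
      show "(if x = x0 then 1 else 0) - \<epsilon> \<le> D (t + x + q) - D (t + x)"
        using x0 step[of "t + x"] by auto
    qed
    also have "(\<Sum>x<L. (if x = x0 then 1 else 0) - \<epsilon>) = 1 - real L * \<epsilon>"
      using x0 by (simp add: sum_subtractf)
    finally show ?thesis .
  qed
  have U_grow: "U (j * L) - U 0 \<ge> real j * (1 - real L * \<epsilon>)" for j
  proof (induction j)
    case (Suc j)
    then show ?case
      using U_window[of "j * L"] by (simp add: algebra_simps)
  qed simp
  have U_bound: "U n - U 0 \<le> real q" for n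
  proof -
    have "U n - U 0 = (\<Sum>i<q. D (n + i) - D i)"
      by (simp add: U_def sum_subtractf)
    also have "\<dots> \<le> (\<Sum>i<q. 1)"
      using discrepancy_bound[OF D] by (intro sum_mono) (metis abs_le_D1)
    finally show ?thesis
      by simp
  qed
  obtain j where "real q < real j * (1 - real L * \<epsilon>)"
    using reals_Archimedean3[of "1 - real L * \<epsilon>"] eps(3) by auto
  then show False
    using U_grow[of j] U_bound[of "j * L"] by linarith
qed

lemma discrepancy_long_run:
  assumes D: "discrepancy \<alpha> D"
    and eps: "\<epsilon> = real q * \<alpha> - of_int p" "\<epsilon> \<noteq> 0" "real L * \<bar>\<epsilon>\<bar> < 1"
  shows "\<exists>t. \<forall>x<L. D (t + x + q) = D (t + x) - \<epsilon>"
proof (cases "\<epsilon> > 0")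
  case True
  then show ?thesis
    using discrepancy_long_run_pos[OF D eps(1)] eps(3) by simp
next
  case False
  have "\<exists>t. \<forall>x<L. - D (t + x + q) = - D (t + x) - (- \<epsilon>)"
    by (rule discrepancy_long_run_pos[OF discrepancy_minus[OF D], of _ _ "- p"])
       (use False eps in auto)
  then obtain t where t: "\<forall>x<L. - D (t + x + q) = - D (t + x) - (- \<epsilon>)"
    by blast
  have "D (t + x + q) = D (t + x) - \<epsilon>" if "x < L" for x
    using t[rule_format, OF that] by linarith
  then show ?thesis
    by blast
qed

lemma discrepancy_short_run_pos:
  assumes D: "discrepancy \<alpha> D" and "0 < \<epsilon>" "0 < R"
    and run: "\<And>x. x < R \<Longrightarrow> D (t + x + q) = D (t + x) - \<epsilon>"
    and Q1: "0 < real Q1 * \<alpha> - of_int P1" "real Q1 * \<alpha> - of_int P1 < \<epsilon>"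
    and Q2: "0 < of_int P2 - real Q2 * \<alpha>" "of_int P2 - real Q2 * \<alpha> < \<epsilon>"
  shows "R < Q1 + Q2"
proof -
  \<comment> \<open>Both \<open>D n\<close> and \<open>D n - \<epsilon>\<close> are values of
    \<open>D\<close>. Oscillation at most 1 therefore leaves no room for a wrap-around when
    \<open>D\<close> moves down by \<delta> modulo 1 with 0 < \<delta> < \<epsilon>.\<close>
  have step: "D b = D n - \<delta>"
    if n: "t \<le> n" "n < t + R" and b: "D b = D n - \<delta> + of_int j" and \<delta>: "0 < \<delta>" "\<delta> < \<epsilon>"
    for n b \<delta> and j :: int
  proof -
    have "D (n + q) = D n - \<epsilon>"
      using run[of "n - t"] n by simp
    moreover have "\<bar>D b - D (n + q)\<bar> \<le> 1" "\<bar>D b - D n\<bar> \<le> 1"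
      using discrepancy_bound[OF D] by blast+
    ultimately have "- 1 < real_of_int j" "real_of_int j < 1"
      using b \<delta> by linarith+
    then have "j = 0"
      by linarith
    then show ?thesis
      using b by simp
  qed
  \<comment> \<open>A minimum n of D on the run: going forward by Q1 or back by Q2 lowers D, so both must leave the run.\<close>
  obtain n where n: "t \<le> n" "n < t + R" and min: "\<And>b. t \<le> b \<Longrightarrow> b < t + R \<Longrightarrow> D n \<le> D b"
  proof -
    have "\<exists>n\<in>{t..<t + R}. \<forall>b\<in>{t..<t + R}. D n \<le> D b"
      using arg_min_if_finite[of "{t..<t + R}" D] \<open>0 < R\<close>
      by (intro bexI[of _ "arg_min_on D {t..<t + R}"]) (auto simp: not_less[symmetric])
    then show ?thesis
      using that by auto
  qed
  have "t + R \<le> n + Q1"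
  proof (rule ccontr)
    assume less: "\<not> t + R \<le> n + Q1"
    obtain j where j: "D (n + Q1) = D n - (real Q1 * \<alpha> - of_int P1) + of_int j"
      using discrepancy_step[OF D] .
    have "D (n + Q1) < D n"
      using step[OF n j Q1] Q1 by linarith
    then show False
      using min[of "n + Q1"] n less by simp
  qed
  moreover have "n < t + Q2"
  proof (rule ccontr)
    assume ge: "\<not> n < t + Q2"
    obtain j where "D (n - Q2 + Q2) = D (n - Q2) - (real Q2 * \<alpha> - of_int P2) + of_int j"
      using discrepancy_step[OF D] .
    then have j: "D (n - Q2) = D n - (of_int P2 - real Q2 * \<alpha>) + of_int (- j)"
      using ge by simp
    have "D (n - Q2) < D n"
      using step[OF n j Q2] Q2 by linarith
    then show False
    proof -
      have "t \<le> n - Q2" "n - Q2 < t + R"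
        using n ge by linarith+
      then show ?thesis
        using min[of "n - Q2"] \<open>D (n - Q2) < D n\<close> by linarith
    qed
  qed
  ultimately show ?thesis
    by simp
qed

lemma discrepancy_short_run:
  assumes D: "discrepancy \<alpha> D" and "\<epsilon> \<noteq> 0" "0 < R"
    and run: "\<And>x. x < R \<Longrightarrow> D (t + x + q) = D (t + x) - \<epsilon>"
    and Q1: "0 < real Q1 * \<alpha> - of_int P1" "real Q1 * \<alpha> - of_int P1 < \<bar>\<epsilon>\<bar>"
    and Q2: "0 < of_int P2 - real Q2 * \<alpha>" "of_int P2 - real Q2 * \<alpha> < \<bar>\<epsilon>\<bar>"
  shows "R < Q1 + Q2"
proof (cases "\<epsilon> > 0")
  case True
  then show ?thesis
    using discrepancy_short_run_pos[OF D True \<open>0 < R\<close> run Q1(1) _ Q2(1)] Q1 Q2 by simp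
next
  case False
  \<comment> \<open>Reflection turns approximations from below into approximations from above, so
    \<open>Q1\<close> and \<open>Q2\<close> exchange their roles.\<close>
  have "R < Q2 + Q1"
    by (rule discrepancy_short_run_pos[OF discrepancy_minus[OF D], of "- \<epsilon>" R t q Q2 "- P2" "- P1"])
       (use False assms in auto)
  then show ?thesis
    by simp
qed

subsection \<open>Continued fractions\<close>

text \<open>The upper bound, uniform in \<open>n\<close>, keeps the reciprocals of tails away from
  0, so that limits can be passed through the inversion.\<close>

lemma finite_cfrac_bounds:
  assumes "\<And>i. m i \<ge> 1"
  shows "1 \<le> finite_cfrac m n \<and> finite_cfrac m n \<le> of_int (m 0) + 1"
  using assms
proof (induction n arbitrary: m)
  case 0
  from 0[of 0] show ?case
    by simp
next
  case (Suc n)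
  have f: "1 \<le> finite_cfrac (\<lambda>i. m (Suc i)) n"
    using Suc.IH[of "\<lambda>i. m (Suc i)"] Suc.prems by blast
  moreover have "1 \<le> real_of_int (m 0)"
    using Suc.prems[of 0] by simp
  moreover have "0 \<le> 1 / finite_cfrac (\<lambda>i. m (Suc i)) n" "1 / finite_cfrac (\<lambda>i. m (Suc i)) n \<le> 1"
    using f by simp_all
  ultimately show ?case
    unfolding finite_cfrac.simps by linarith
qed

lemma cfrac_expansion_tail:
  assumes "cfrac_expansion \<alpha> m"
  shows "\<exists>a\<ge>1. cfrac_expansion a (\<lambda>i. m (Suc i)) \<and> \<alpha> = of_int (m 0) + 1 / a"
proof -
  let ?m = "\<lambda>i. m (Suc i)" and ?f = "finite_cfrac (\<lambda>i. m (Suc i))"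
  have m: "\<And>i. ?m i \<ge> 1" and lim: "finite_cfrac m \<longlonglongrightarrow> \<alpha>"
    using assms by (auto simp: cfrac_expansion_def)
  note bounds = finite_cfrac_bounds[of ?m, OF m]
  have "(\<lambda>n. finite_cfrac m (Suc n) - of_int (m 0)) \<longlonglongrightarrow> \<alpha> - of_int (m 0)"
    using lim by (intro tendsto_intros LIMSEQ_Suc)
  then have inv: "(\<lambda>n. 1 / ?f n) \<longlonglongrightarrow> \<alpha> - of_int (m 0)"
    by simp
  have "1 / (of_int (?m 0) + 1) \<le> 1 / ?f n" for n
    using bounds[of n] by (intro divide_left_mono) auto
  then have "1 / (of_int (?m 0) + 1) \<le> \<alpha> - of_int (m 0)"
    by (intro LIMSEQ_le_const[OF inv]) auto
  moreover have "0 < 1 / (real_of_int (?m 0) + 1)"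
    using m[of 0] by simp
  ultimately have pos: "\<alpha> - of_int (m 0) > 0"
    by linarith
  have "(\<lambda>n. 1 / (1 / ?f n)) \<longlonglongrightarrow> 1 / (\<alpha> - of_int (m 0))"
    using inv pos by (intro tendsto_intros) auto
  then have f: "?f \<longlonglongrightarrow> 1 / (\<alpha> - of_int (m 0))"
    by simp
  moreover have "1 \<le> 1 / (\<alpha> - of_int (m 0))"
    using bounds by (intro LIMSEQ_le_const[OF f]) auto
  ultimately show ?thesis
    using m by (intro exI[of _ "1 / (\<alpha> - of_int (m 0))"]) (auto simp: cfrac_expansion_def)
qed

text \<open>The complete quotients are the limits of the tails. They exceed 1 strictly because each
  is a partial quotient at least 1 plus a positive reciprocal.\<close>

lemma cfrac_complete_quotients:
  assumes "cfrac_expansion \<alpha> m"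
  obtains a where "a 0 = \<alpha>" "\<And>k. a k = of_int (m k) + 1 / a (Suc k)" "\<And>k. a (Suc k) > 1"
proof -
  define a where "a k = lim (finite_cfrac (\<lambda>i. m (k + i)))" for k
  have lim: "a k = x" if "cfrac_expansion x (\<lambda>i. m (k + i))" for k x
    using that unfolding a_def cfrac_expansion_def by (intro limI) simp
  have exp: "cfrac_expansion (a k) (\<lambda>i. m (k + i))" for k
  proof (induction k)
    case 0
    then show ?case
      using assms lim[of \<alpha> 0] by simp
  next
    case (Suc k)
    then obtain b where b: "cfrac_expansion b (\<lambda>i. m (k + Suc i))"
      using cfrac_expansion_tail by blast
    then show ?case
      using lim[of b "Suc k"] by simp
  qed
  have a: "a 0 = \<alpha>" "a k = of_int (m k) + 1 / a (Suc k)" "a (Suc k) \<ge> 1" for k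
  proof -
    show "a 0 = \<alpha>"
      using assms by (intro lim) simp
    obtain b where b: "b \<ge> 1" "cfrac_expansion b (\<lambda>i. m (k + Suc i))" "a k = of_int (m (k + 0)) + 1 / b"
      using cfrac_expansion_tail[OF exp] by blast
    then have "a (Suc k) = b"
      by (intro lim) simp
    then show "a k = of_int (m k) + 1 / a (Suc k)" "a (Suc k) \<ge> 1"
      using b by simp_all
  qed
  have "a (Suc k) > 1" for k
  proof -
    have "real_of_int (m (Suc k)) \<ge> 1"
      using assms by (simp add: cfrac_expansion_def)
    moreover have "1 / a (Suc (Suc k)) > 0"
      using a(3)[of "Suc k"] by simp
    ultimately show ?thesis
      using a(2)[of "Suc k"] by linarith
  qed
  then show ?thesis
    using that a(1,2) by blast
qed

section \<open>Convergents and their errors\<close>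

fun cf_num :: "(nat \<Rightarrow> int) \<Rightarrow> nat \<Rightarrow> int" where
  "cf_num m 0 = m 0"
| "cf_num m (Suc 0) = m 1 * m 0 + 1"
| "cf_num m (Suc (Suc k)) = m (Suc (Suc k)) * cf_num m (Suc k) + cf_num m k"

fun cf_den :: "(nat \<Rightarrow> int) \<Rightarrow> nat \<Rightarrow> int" where
  "cf_den m 0 = 1"
| "cf_den m (Suc 0) = m 1"
| "cf_den m (Suc (Suc k)) = m (Suc (Suc k)) * cf_den m (Suc k) + cf_den m k"

lemma cf_det: "cf_den m k * cf_num m (Suc k) - cf_den m (Suc k) * cf_num m k = (- 1) ^ k"
proof (induction k)
  case (Suc k)
  have "cf_den m (Suc k) * cf_num m (Suc (Suc k)) - cf_den m (Suc (Suc k)) * cf_num m (Suc k)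
    = - (cf_den m k * cf_num m (Suc k) - cf_den m (Suc k) * cf_num m k)"
    by (simp add: algebra_simps)
  also have "\<dots> = (- 1) ^ Suc k"
    by (simp only: Suc.IH power_Suc mult_minus1)
  finally show ?case .
qed simp

definition cf_err :: "real \<Rightarrow> (nat \<Rightarrow> int) \<Rightarrow> nat \<Rightarrow> real" where
  "cf_err \<alpha> m k = of_int (cf_den m k) * \<alpha> - of_int (cf_num m k)"

context
  fixes \<alpha> :: real and m :: "nat \<Rightarrow> int"
  assumes cf: "cfrac_expansion \<alpha> m"
begin

private lemma m_ge_1: "m (Suc i) \<ge> 1"
  using cf by (simp add: cfrac_expansion_def)

lemma cf_den_pos: "cf_den m k \<ge> 1"
proof (induction k rule: induct_nat_012)
  case (ge2 k)
  then show ?case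
    using mult_mono[of 1 "m (Suc (Suc k))" 1 "cf_den m (Suc k)"] m_ge_1[of "Suc k"] by simp
qed (use m_ge_1[of 0] in auto)

lemma cf_den_Suc_ge: "m (Suc k) * cf_den m k \<le> cf_den m (Suc k)"
  using cf_den_pos by (cases k) (auto intro: order_trans[OF zero_le_one])

lemma cf_den_mono: "cf_den m k \<le> cf_den m (Suc k)"
  using cf_den_Suc_ge[of k] mult_right_mono[OF m_ge_1[of k], of "cf_den m k"] cf_den_pos[of k] by linarith

lemma cf_den_ge: "cf_den m k \<ge> int k"
proof (induction k rule: induct_nat_012)
  case (ge2 k)
  have "cf_den m (Suc k) \<le> m (Suc (Suc k)) * cf_den m (Suc k)"
    using mult_right_mono[OF m_ge_1[of "Suc k"], of "cf_den m (Suc k)"] cf_den_pos[of "Suc k"] by simp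
  then have "cf_den m (Suc k) + 1 \<le> cf_den m (Suc (Suc k))"
    using cf_den_pos[of k] unfolding cf_den.simps by linarith
  then show ?case
    using ge2(2) by linarith
qed (use m_ge_1[of 0] in auto)

lemma cf_den_Suc_le: "m (Suc k) \<le> M \<Longrightarrow> cf_den m (Suc k) \<le> (M + 1) * cf_den m k"
proof -
  assume M: "m (Suc k) \<le> M"
  have "cf_den m (Suc k) \<le> (m (Suc k) + 1) * cf_den m k"
    using cf_den_mono by (cases k) (auto simp: algebra_simps)
  also have "\<dots> \<le> (M + 1) * cf_den m k"
    using M cf_den_pos[of k] by (intro mult_right_mono) auto
  finally show ?thesis .
qed

text \<open>Inserting \<open>m k = a k - 1 / a (Suc k)\<close> into the recurrence of the errors
  makes them shrink by a complete quotient and change sign at each step. The sequence obtained here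
  is that of the complete quotients with index shifted by 2.\<close>

lemma cf_err_Suc:
  obtains a :: "nat \<Rightarrow> real" where "\<And>k. a k > 1" "\<And>k. cf_err \<alpha> m (Suc k) = - cf_err \<alpha> m k / a k" "cf_err \<alpha> m 0 > 0"
proof -
  obtain a where a: "a 0 = \<alpha>" "\<And>k. a k = of_int (m k) + 1 / a (Suc k)" "\<And>k. a (Suc k) > 1"
    using cfrac_complete_quotients[OF cf] by blast
  have nz: "a (Suc k) \<noteq> 0" for k
    using a(3)[of k] by simp
  have m: "of_int (m k) = a k - 1 / a (Suc k)" for k
    using a(2)[of k] by simp
  have e0: "cf_err \<alpha> m 0 = 1 / a 1"
    using a(1) a(2)[of 0] by (simp add: cf_err_def)
  have "cf_err \<alpha> m (Suc k) = - cf_err \<alpha> m k / a (Suc (Suc k))" for k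
  proof (induction k)
    case 0
    have "cf_err \<alpha> m (Suc 0) = of_int (m 1) * cf_err \<alpha> m 0 - 1"
      by (simp add: cf_err_def algebra_simps)
    also have "\<dots> = - cf_err \<alpha> m 0 / a (Suc (Suc 0))"
      unfolding m e0 using nz[of 0] nz[of 1] by (simp add: field_simps)
    finally show ?case .
  next
    case (Suc k)
    have "cf_err \<alpha> m k = - a (Suc (Suc k)) * cf_err \<alpha> m (Suc k)"
      unfolding Suc using nz[of "Suc k"] by simp
    moreover have "cf_err \<alpha> m (Suc (Suc k)) = of_int (m (Suc (Suc k))) * cf_err \<alpha> m (Suc k) + cf_err \<alpha> m k"
      by (simp add: cf_err_def algebra_simps)
    ultimately show ?case
      by (simp add: m algebra_simps)
  qed
  then show ?thesis
    using that[of "\<lambda>k. a (Suc (Suc k))"] a(3) e0 a(3)[of 0] by simp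
qed

lemma cf_err_sign: "(- 1) ^ k * cf_err \<alpha> m k > 0"
proof -
  obtain a :: "nat \<Rightarrow> real" where a: "\<And>k. a k > 1" "\<And>k. cf_err \<alpha> m (Suc k) = - cf_err \<alpha> m k / a k" "cf_err \<alpha> m 0 > 0"
    using cf_err_Suc by blast
  show ?thesis
  proof (induction k)
    case (Suc k)
    have "(- 1) ^ Suc k * cf_err \<alpha> m (Suc k) = (- 1) ^ k * cf_err \<alpha> m k / a k"
      by (simp add: a(2))
    also have "\<dots> > 0"
      using Suc a(1)[of k] by (intro divide_pos_pos) auto
    finally show ?case .
  qed (use a in simp)
qed

lemma abs_cf_err: "\<bar>cf_err \<alpha> m k\<bar> = (- 1) ^ k * cf_err \<alpha> m k"
  using cf_err_sign[of k] by (cases "even k") simp_all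

lemma cf_err_decreasing: "\<bar>cf_err \<alpha> m (Suc k)\<bar> < \<bar>cf_err \<alpha> m k\<bar>"
proof -
  obtain a :: "nat \<Rightarrow> real" where a: "\<And>k. a k > 1" "\<And>k. cf_err \<alpha> m (Suc k) = - cf_err \<alpha> m k / a k" "cf_err \<alpha> m 0 > 0"
    using cf_err_Suc by blast
  have "\<bar>cf_err \<alpha> m k\<bar> > 0"
    unfolding abs_cf_err by (rule cf_err_sign)
  then have "\<bar>cf_err \<alpha> m k\<bar> / a k < \<bar>cf_err \<alpha> m k\<bar> / 1"
    using a(1)[of k] by (intro divide_strict_left_mono) auto
  then show ?thesis
    using a(1)[of k] by (simp add: a(2))
qed

text \<open>By the determinant identity and the alternating signs, \<open>cf_den m (Suc k)\<close>
  times the \<open>k\<close>-th absolute error plus \<open>cf_den m k\<close> times the next one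
  equals 1. The second summand is positive, and \<open>cf_den m (Suc k)\<close> is at least
  \<open>m (Suc k) * cf_den m k\<close>.\<close>

lemma cf_err_upper: "of_int (m (Suc k) * cf_den m k) * \<bar>cf_err \<alpha> m k\<bar> < 1"
proof -
  have "of_int (cf_den m (Suc k)) * cf_err \<alpha> m k - of_int (cf_den m k) * cf_err \<alpha> m (Suc k)
    = of_int (cf_den m k * cf_num m (Suc k) - cf_den m (Suc k) * cf_num m k)"
    by (simp add: cf_err_def algebra_simps)
  also have "\<dots> = (- 1) ^ k"
    by (simp add: cf_det)
  finally have "(- 1) ^ k * (of_int (cf_den m (Suc k)) * cf_err \<alpha> m k - of_int (cf_den m k) * cf_err \<alpha> m (Suc k)) = (1::real)"
    by (cases "even k") simp_all
  then have "of_int (cf_den m (Suc k)) * \<bar>cf_err \<alpha> m k\<bar> + of_int (cf_den m k) * \<bar>cf_err \<alpha> m (Suc k)\<bar> = 1"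
    by (simp add: abs_cf_err algebra_simps)
  moreover have "0 < of_int (cf_den m k) * \<bar>cf_err \<alpha> m (Suc k)\<bar>"
    using cf_den_pos[of k] cf_err_sign[of "Suc k"] by (intro mult_pos_pos) auto
  moreover have "of_int (m (Suc k) * cf_den m k) * \<bar>cf_err \<alpha> m k\<bar> \<le> of_int (cf_den m (Suc k)) * \<bar>cf_err \<alpha> m k\<bar>"
    using cf_den_Suc_ge[of k] by (intro mult_right_mono) (simp_all only: of_int_le_iff abs_ge_zero)
  ultimately show ?thesis
    by linarith
qed

text \<open>The law of best approximation. The pair \<open>(q, P)\<close> is an integral combination
  of two consecutive convergents; the bound on \<open>q\<close> makes the first coefficient nonzero
  and forbids equal signs. Since the errors alternate, the two contributions add up.\<close>

lemma cf_err_best: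
  assumes "1 \<le> q" "q < cf_den m (Suc k)"
  shows "\<bar>cf_err \<alpha> m k\<bar> \<le> \<bar>of_int q * \<alpha> - of_int P\<bar>"
proof -
  let ?e = "(- 1) ^ k :: int" and ?q = "cf_den m k" and ?q' = "cf_den m (Suc k)"
    and ?p = "cf_num m k" and ?p' = "cf_num m (Suc k)"
  \<comment> \<open>Cramer's rule for the system whose determinant is 1 or -1 by
    \<open>cf_det\<close>, so the coefficients are integers.\<close>
  define x where "x = ?e * (q * ?p' - P * ?q')"
  define y where "y = ?e * (P * ?q - q * ?p)"
  have ee: "?e * ?e = 1"
    by (cases "even k") simp_all
  have "x * ?q + y * ?q' = ?e * (?q * ?p' - ?q' * ?p) * q"
    by (simp add: x_def y_def algebra_simps)
  then have q: "x * ?q + y * ?q' = q"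
    by (simp only: cf_det ee mult_1)
  have "x * ?p + y * ?p' = ?e * (?q * ?p' - ?q' * ?p) * P"
    by (simp add: x_def y_def algebra_simps)
  then have p: "x * ?p + y * ?p' = P"
    by (simp only: cf_det ee mult_1)
  have pos: "?q \<ge> 1" "?q' \<ge> 1"
    by (rule cf_den_pos)+
  have split: "of_int q * \<alpha> - of_int P = of_int x * cf_err \<alpha> m k + of_int y * cf_err \<alpha> m (Suc k)"
    unfolding q[symmetric] p[symmetric] cf_err_def by (simp add: algebra_simps)
  have signs: "x \<ge> 1 \<and> y \<le> 0 \<or> x \<le> - 1 \<and> y \<ge> 0"
  proof -
    consider "y \<ge> 1" | "y = 0" | "y \<le> - 1"
      by linarith
    then show ?thesis
    proof cases
      case 1
      have "\<not> x \<ge> 0"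
      proof
        assume "x \<ge> 0"
        then have "x * ?q \<ge> 0" "1 * ?q' \<le> y * ?q'"
          using pos 1 by (intro mult_nonneg_nonneg mult_right_mono; simp)+
        then show False
          using q assms by linarith
      qed
      then show ?thesis
        using 1 by linarith
    next
      case 2
      then have "x \<noteq> 0"
        using q assms by auto
      then show ?thesis
        using 2 by linarith
    next
      case 3
      have "\<not> x \<le> 0"
      proof
        assume "x \<le> 0"
        then have "x * ?q \<le> 0" "y * ?q' \<le> 0"
          using pos 3 by (intro mult_nonpos_nonneg; simp)+
        then show False
          using q assms by linarith
      qed
      then show ?thesis
        using 3 by linarith
    qed
  qed
  let ?s = "(- 1) ^ k :: real"
  have "?s * (of_int q * \<alpha> - of_int P) = of_int x * \<bar>cf_err \<alpha> m k\<bar> - of_int y * \<bar>cf_err \<alpha> m (Suc k)\<bar>"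
    unfolding split abs_cf_err by (simp add: algebra_simps)
  then have "\<bar>of_int q * \<alpha> - of_int P\<bar> = \<bar>of_int x * \<bar>cf_err \<alpha> m k\<bar> - of_int y * \<bar>cf_err \<alpha> m (Suc k)\<bar>\<bar>"
    by (cases "even k") (simp_all add: abs_minus_commute)
  also have "\<dots> \<ge> \<bar>cf_err \<alpha> m k\<bar>"
    using signs
  proof
    assume "x \<ge> 1 \<and> y \<le> 0"
    then have "1 * \<bar>cf_err \<alpha> m k\<bar> \<le> of_int x * \<bar>cf_err \<alpha> m k\<bar>" "of_int y * \<bar>cf_err \<alpha> m (Suc k)\<bar> \<le> 0"
      by (intro mult_right_mono mult_nonpos_nonneg; simp)+
    then show ?thesis
      by linarith
  next
    assume "x \<le> - 1 \<and> y \<ge> 0"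
    then have "of_int x * \<bar>cf_err \<alpha> m k\<bar> \<le> of_int (- 1) * \<bar>cf_err \<alpha> m k\<bar>" "0 \<le> of_int y * \<bar>cf_err \<alpha> m (Suc k)\<bar>"
      by (intro mult_right_mono mult_nonneg_nonneg; simp only: of_int_le_iff; simp)+
    then show ?thesis
      by simp
  qed
  finally show ?thesis .
qed

text \<open>Let \<open>k\<close> satisfy \<open>cf_den m k \<le> q < cf_den m (Suc k)\<close>. The
  next two convergents lie on opposite sides, have smaller errors than the \<open>k\<close>-th and
  hence than \<open>q\<close>, and their denominators are at most \<open>(M + 1) * q\<close> and
  \<open>(M + 1) * (M + 1) * q\<close>.\<close>

lemma two_sided_approximation:
  assumes M: "\<And>i. m (Suc i) \<le> M" and q: "1 \<le> q"
  shows "\<exists>Q1 Q2 P1 P2. Q1 + Q2 \<le> (M + 1) * (M + 2) * q \<and> 0 < Q1 \<and> 0 < Q2 \<and>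
    0 < of_int Q1 * \<alpha> - of_int P1 \<and> of_int Q1 * \<alpha> - of_int P1 < \<bar>of_int q * \<alpha> - of_int P\<bar> \<and>
    0 < of_int P2 - of_int Q2 * \<alpha> \<and> of_int P2 - of_int Q2 * \<alpha> < \<bar>of_int q * \<alpha> - of_int P\<bar>"
proof -
  have "\<exists>k. q < cf_den m k"
    using cf_den_ge[of "nat q + 1"] q by (intro exI[of _ "nat q + 1"]) linarith
  then have "q < cf_den m (LEAST k. q < cf_den m k)"
    by (rule LeastI_ex)
  moreover have "(LEAST k. q < cf_den m k) \<noteq> 0"
    using calculation q by (metis cf_den.simps(1) not_less)
  ultimately obtain k where k: "q < cf_den m (Suc k)" "cf_den m k \<le> q"
    by (metis not0_implies_Suc not_less_Least lessI not_less)
  have best: "\<bar>cf_err \<alpha> m k\<bar> \<le> \<bar>of_int q * \<alpha> - of_int P\<bar>"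
    by (rule cf_err_best[OF q k(1)])
  have M1: "M \<ge> 1"
    using M[of 0] m_ge_1[of 0] by linarith
  let ?q1 = "cf_den m (Suc k)" and ?q2 = "cf_den m (Suc (Suc k))"
  have 1: "?q1 \<le> (M + 1) * q"
    using cf_den_Suc_le[OF M, of k] k(2) mult_left_mono[OF k(2), of "M + 1"] M1 by linarith
  have "?q2 \<le> (M + 1) * ?q1"
    by (rule cf_den_Suc_le[OF M])
  also have "\<dots> \<le> (M + 1) * ((M + 1) * q)"
    using 1 M1 by (intro mult_left_mono) auto
  finally have sum: "?q1 + ?q2 \<le> (M + 1) * (M + 2) * q"
    using 1 by (simp add: algebra_simps)
  have small: "\<bar>cf_err \<alpha> m (Suc k)\<bar> < \<bar>of_int q * \<alpha> - of_int P\<bar>"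
    "\<bar>cf_err \<alpha> m (Suc (Suc k))\<bar> < \<bar>of_int q * \<alpha> - of_int P\<bar>"
    using best cf_err_decreasing[of k] cf_err_decreasing[of "Suc k"] by linarith+
  have pos: "0 < ?q1" "0 < ?q2"
    using cf_den_pos[of "Suc k"] cf_den_pos[of "Suc (Suc k)"] by linarith+
  note errs = cf_err_def[of \<alpha> m "Suc k"] cf_err_def[of \<alpha> m "Suc (Suc k)"]
  show ?thesis
  proof (cases "even k")
    case True
    then have "cf_err \<alpha> m (Suc k) < 0" "cf_err \<alpha> m (Suc (Suc k)) > 0"
      using cf_err_sign[of "Suc k"] cf_err_sign[of "Suc (Suc k)"] by simp_all
    then show ?thesis
      using sum small pos unfolding errs
      by (intro exI[of _ ?q2] exI[of _ ?q1] exI[of _ "cf_num m (Suc (Suc k))"] exI[of _ "cf_num m (Suc k)"] conjI;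
          linarith)
  next
    case False
    then have "cf_err \<alpha> m (Suc k) > 0" "cf_err \<alpha> m (Suc (Suc k)) < 0"
      using cf_err_sign[of "Suc k"] cf_err_sign[of "Suc (Suc k)"] by simp_all
    then show ?thesis
      using sum small pos unfolding errs
      by (intro exI[of _ ?q1] exI[of _ ?q2] exI[of _ "cf_num m (Suc k)"] exI[of _ "cf_num m (Suc (Suc k))"] conjI;
          linarith)
  qed
qed

end

subsection \<open>Bounded runs and bounded partial quotients\<close>

text \<open>A letter is recovered from two consecutive values of \<open>disc s\<close>, so a run of
  letters is obtained that is one position shorter than the run of \<open>disc s\<close>.\<close>

lemma disc_run:
  assumes "disc s (t + x + q) = disc s (t + x) - \<epsilon>" "disc s (t + Suc x + q) = disc s (t + Suc x) - \<epsilon>"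
  shows "s (t + x + q) = s (t + x)"
proof -
  have "disc s (Suc n) - disc s n = real (s n) - slope s" for n
    using disc_diff[of s n 1] by (simp add: ones_def)
  from this[of "t + x + q"] this[of "t + x"] show ?thesis
    using assms by simp
qed

text \<open>With \<epsilon> the error of the \<open>k\<close>-th convergent and \<open>q\<close> its
  denominator, \<open>m (Suc k) * q * \<bar>\<epsilon>\<bar> < 1\<close>. If also
  \<open>(K + 2) * q * \<bar>\<epsilon>\<bar> < 1\<close>, there would be a run of period
  \<open>q\<close> longer than \<open>K * q\<close>.\<close>

lemma bounded_runs_imp_cfrac_bounded:
  assumes st: "sturmian s" and br: "bounded_runs s K" and cf: "cfrac_expansion (slope s) m"
  shows "m (Suc k) \<le> int K + 2"
proof -
  define q where "q = nat (cf_den m k)"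
  define \<epsilon> where "\<epsilon> = cf_err (slope s) m k"
  \<comment> \<open>One position is lost in passing to letters, and \<open>L - 1\<close> must still
    exceed \<open>K * q\<close>; for \<open>q = 1\<close> the factor \<open>K + 1\<close> would fall
    short.\<close>
  define L where "L = (K + 2) * q"
  have q: "q > 0" "int q = cf_den m k"
    using cf_den_pos[OF cf, of k] by (simp_all add: q_def)
  then have real_q: "real q = of_int (cf_den m k)"
    by (metis of_int_of_nat_eq)
  have \<epsilon>: "\<epsilon> = real q * slope s - of_int (cf_num m k)"
    by (simp add: \<epsilon>_def cf_err_def real_q)
  have "\<epsilon> \<noteq> 0"
    using cf_err_sign[OF cf, of k] by (auto simp: \<epsilon>_def)
  have "\<not> real L * \<bar>\<epsilon>\<bar> < 1"
  proof
    assume "real L * \<bar>\<epsilon>\<bar> < 1"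
    then obtain t where t: "\<And>x. x < L \<Longrightarrow> disc s (t + x + q) = disc s (t + x) - \<epsilon>"
      using discrepancy_long_run[OF discrepancy_disc[OF st] \<epsilon> \<open>\<epsilon> \<noteq> 0\<close>] by blast
    have "s (t + x + q) = s (t + x)" if "x < L - 1" for x
      using that by (intro disc_run[where \<epsilon> = \<epsilon>] t) auto
    then have "L - 1 \<le> K * q"
      by (rule bounded_runsD[OF br q(1)])
    then show False
      using q by (simp add: L_def)
  qed
  moreover have "of_int (m (Suc k)) * (real q * \<bar>\<epsilon>\<bar>) < 1"
    using cf_err_upper[OF cf, of k] by (simp add: \<epsilon>_def real_q mult.assoc)
  moreover have "real L * \<bar>\<epsilon>\<bar> = of_int (int K + 2) * (real q * \<bar>\<epsilon>\<bar>)"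
    by (simp add: L_def algebra_simps)
  ultimately have "of_int (m (Suc k)) * (real q * \<bar>\<epsilon>\<bar>) < of_int (int K + 2) * (real q * \<bar>\<epsilon>\<bar>)"
    by linarith
  moreover have "real q * \<bar>\<epsilon>\<bar> > 0"
    using q \<open>\<epsilon> \<noteq> 0\<close> by simp
  ultimately have "real_of_int (m (Suc k)) < of_int (int K + 2)"
    by (simp only: mult_less_cancel_right_pos)
  then show ?thesis
    by linarith
qed

text \<open>Along a run all windows of length \<open>q\<close> contain equally many ones, so
  \<open>disc s\<close> drops by a fixed \<epsilon> under the shift by \<open>q\<close>.
  Approximations from both sides that are better than \<epsilon> then bound the length of the
  run.\<close>

lemma cfrac_bounded_imp_bounded_runs:
  assumes st: "sturmian s" and cf: "cfrac_expansion (slope s) m" and M: "\<And>i. m (Suc i) \<le> M"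
  shows "bounded_runs s (nat ((M + 1) * (M + 2)))"
  unfolding bounded_runs_def
proof (intro allI impI)
  fix q t R :: nat
  assume "q > 0" and run: "\<forall>x<R. s (t + x + q) = s (t + x)"
  define \<epsilon> where "\<epsilon> = real q * slope s - real (ones s t q)"
  have "ones s (t + x) q = ones s t q" if "x \<le> R" for x
    using that
  proof (induction x)
    case (Suc x)
    have "ones s (t + x) (Suc q) = s (t + x) + ones s (t + Suc x) q"
      using ones_add[of s "t + x" 1 q] by (simp add: ones_def)
    then show ?case
      using Suc run by (simp add: ones_Suc)
  qed simp
  then have disc: "disc s (t + x + q) = disc s (t + x) - \<epsilon>" if "x < R" for x
    using disc_diff[of s "t + x" q] that by (simp add: \<epsilon>_def)
  obtain Q1 Q2 P1 P2 where Q: "Q1 + Q2 \<le> (M + 1) * (M + 2) * int q" "0 < Q1" "0 < Q2"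
    and Q1: "0 < of_int Q1 * slope s - of_int P1" "of_int Q1 * slope s - of_int P1 < \<bar>\<epsilon>\<bar>"
    and Q2: "0 < of_int P2 - of_int Q2 * slope s" "of_int P2 - of_int Q2 * slope s < \<bar>\<epsilon>\<bar>"
    using two_sided_approximation[OF cf M, of "int q" "int (ones s t q)"] \<open>q > 0\<close>
    by (auto simp: \<epsilon>_def)
  have "\<epsilon> \<noteq> 0"
    using Q1 by auto
  have nats: "real (nat Q1) = of_int Q1" "real (nat Q2) = of_int Q2"
    using Q by simp_all
  have "R \<le> nat Q1 + nat Q2"
  proof (cases "R = 0")
    case False
    then have "R < nat Q1 + nat Q2"
      using Q1 Q2 unfolding nats[symmetric]
      by (intro discrepancy_short_run[OF discrepancy_disc[OF st] \<open>\<epsilon> \<noteq> 0\<close> _ disc]) auto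
    then show ?thesis
      by simp
  qed simp
  moreover have "M \<ge> 1"
    using M[of 0] cf unfolding cfrac_expansion_def by (metis One_nat_def order_refl order_trans)
  ultimately have "int R \<le> int (nat ((M + 1) * (M + 2)) * q)"
    using Q by simp
  then show "R \<le> nat ((M + 1) * (M + 2)) * q"
    by (simp only: of_nat_le_iff)
qed

theorem corollary2:
  fixes s :: "nat \<Rightarrow> nat" and \<alpha> :: real and m :: "nat \<Rightarrow> int"
  assumes "sturmian s"
    and "\<alpha> = slope s"
    and "cfrac_expansion \<alpha> m"
  shows "closed_rich s \<longleftrightarrow> bounded ((\<lambda>i. real_of_int (m i)) ` {1..})"
proof
  have cf: "cfrac_expansion (slope s) m"
    using assms by simp
  then have m: "1 \<le> m i" if "1 \<le> i" for i
    using that by (simp add: cfrac_expansion_def)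
  show "bounded ((\<lambda>i. real_of_int (m i)) ` {1..})" if rich: "closed_rich s"
  proof -
    obtain K where K: "bounded_runs s K"
      using closed_rich_imp_bounded_runs[OF rich] by blast
    have "\<bar>real_of_int (m i)\<bar> \<le> real K + 2" if "1 \<le> i" for i
    proof -
      have "m i \<le> int K + 2"
        using bounded_runs_imp_cfrac_bounded[OF assms(1) K cf, of "i - 1"] that by simp
      then show ?thesis
        using m[OF that] by linarith
    qed
    then show ?thesis
      unfolding bounded_iff by auto
  qed
  show "closed_rich s" if bdd: "bounded ((\<lambda>i. real_of_int (m i)) ` {1..})"
  proof -
    obtain B where B: "\<And>i. 1 \<le> i \<Longrightarrow> \<bar>real_of_int (m i)\<bar> \<le> B"
      using bdd unfolding bounded_iff by auto
    have "m (Suc i) \<le> \<lfloor>B\<rfloor>" for i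
      using B[of "Suc i"] by (simp add: le_floor_iff)
    then show ?thesis
      using cfrac_bounded_imp_bounded_runs[OF assms(1) cf]
        bounded_runs_imp_closed_rich[OF assms(1)] by blast
  qed
qed

end
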